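(* Let $X$ be a real random variable with characteristic function $\phi(t)=U(t)+iV(t)$, where $U(t)=E[\cos(tX)]$ and $V(t)=E[\sin(tX)]$, and let $H$ and $K$ be its tail sum and tail difference functions. Suppose that $1-U(t)$ is regularly varying at $0$ with index $k$, where $0<k<2$ and $k\neq 1$, and that for some real constant $c'$ $$V(t)\sim c'\,(1-U(t))\quad\text{as } t\downarrow 0,$$ i.e. $V(t)/(1-U(t))\to c'$ as $t\downarrow 0$. Then the limit $$\beta=\lim_{x\to\infty}\frac{K(x)}{H(x)}$$ exists, $\beta\in[-1,1]$, and $$c'=\beta\tan\left(\frac{\pi k}{2}\right).$$
   Context: $F$ is the intermediate distribution function $F(x)=\tfrac12[P(X<x)+P(X\le x)]$. For $x>0$, $H(x)=1-F(x)+F(-x)$ is the tail sum and $K(x)=1-F(x)-F(-x)$ is the tail difference. A function $f$ is regularly varying at $0$ with index $k$ if $f(\lambda t)/f(t)\to\lambda^{k}$ as $t\downarrow 0$ for every $\lambda>0$. *)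

theory Defs
  imports "HOL-Probability.Probability"
begin

definition intermediate_df :: "'a measure \<Rightarrow> ('a \<Rightarrow> real) \<Rightarrow> real \<Rightarrow> real" where
  "intermediate_df M X x =
     (measure M {\<omega> \<in> space M. X \<omega> < x} + measure M {\<omega> \<in> space M. X \<omega> \<le> x}) / 2"

text \<open>The tail functions are meant for \<open>x > 0\<close>; their values elsewhere are irrelevant.\<close>

definition tail_sum :: "'a measure \<Rightarrow> ('a \<Rightarrow> real) \<Rightarrow> real \<Rightarrow> real" where
  "tail_sum M X x = 1 - intermediate_df M X x + intermediate_df M X (- x)"

definition tail_diff :: "'a measure \<Rightarrow> ('a \<Rightarrow> real) \<Rightarrow> real \<Rightarrow> real" where
  "tail_diff M X x = 1 - intermediate_df M X x - intermediate_df M X (- x)"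

definition cf_U :: "'a measure \<Rightarrow> ('a \<Rightarrow> real) \<Rightarrow> real \<Rightarrow> real" where
  "cf_U M X t = (\<integral>\<omega>. cos (t * X \<omega>) \<partial>M)"

definition cf_V :: "'a measure \<Rightarrow> ('a \<Rightarrow> real) \<Rightarrow> real \<Rightarrow> real" where
  "cf_V M X t = (\<integral>\<omega>. sin (t * X \<omega>) \<partial>M)"

lemma (in prob_space) char_eq_cf_U_cf_V:
  assumes [measurable]: "random_variable borel X"
  shows "char (distr M borel X) t = Complex (cf_U M X t) (cf_V M X t)"
proof -
  have int: "integrable M (\<lambda>\<omega>. iexp (t * X \<omega>))"
    using integrable_iexp[of "\<lambda>\<omega>. complex_of_real (t * X \<omega>)"] by simp
  have "char (distr M borel X) t = (\<integral>\<omega>. iexp (t * X \<omega>) \<partial>M)"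
    unfolding char_def by (subst integral_distr) auto
  then show ?thesis
    using integral_Re[OF int] integral_Im[OF int]
    by (simp add: complex_eq_iff cf_U_def cf_V_def Re_exp Im_exp)
qed

text \<open>
  Division by zero is harmless: the case \<open>l = 1\<close> forces \<open>f t \<noteq> 0\<close> for all
  sufficiently small \<open>t > 0\<close>.
\<close>

definition regularly_varying_at_0 :: "(real \<Rightarrow> real) \<Rightarrow> real \<Rightarrow> bool" where
  "regularly_varying_at_0 f k \<longleftrightarrow>
     (\<forall>l>0. ((\<lambda>t. f (l * t) / f t) \<longlongrightarrow> l powr k) (at_right 0))"

end

theory Submission
  imports Defs "HOL-Real_Asymp.Real_Asymp"
begin

text \<open>
  Write \<open>g t = 1 - U t = E (1 - cos (t X))\<close>. Weighting the law of \<open>t X\<close> with \<open>(1 - cos) / g t\<close>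
  gives a probability measure whose characteristic function is a second difference of
  \<open>(g - i V) / g t\<close>, so it converges pointwise as \<open>t\<close> tends to 0. A dyadic
  decomposition bounds \<open>P (\<bar>t X\<bar> > 2 ^ n) / g t\<close> geometrically, hence the weighted laws are tight and
  converge weakly by Levy's theorem. Dividing out the weight on a shell \<open>(a, 2 a]\<close>
  away from the other zeros of \<open>1 - cos\<close> and summing over dyadic shells shows that both tails of \<open>X\<close>,
  divided by \<open>g (1 / x)\<close>, have limits \<open>p\<close> and \<open>q\<close>; so \<open>\<beta> = (p - q) / (p + q)\<close>.

  Consequently the law of \<open>t X\<close> divided by \<open>g t\<close> converges away from 0 to the measure with density
  \<open>k x powr (- k - 1)\<close>, weighted by \<open>p\<close> and \<open>q\<close> on the two half-lines. Testing this with
  \<open>(1 - cos x)\<^sup>2\<close> and \<open>sin x * (1 - cos x)\<close>, which are integrable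
  against the limit for all \<open>0 < k < 2\<close> and whose expectations are
  combinations of \<open>g\<close> and \<open>V\<close> at \<open>t\<close> and \<open>2 t\<close>, yields two equations for \<open>p\<close> and \<open>q\<close>;
  the tangent is the quotient of the two integrals.
\<close>

section \<open>The trigonometric moments of the power density\<close>

lemma nn_integral_powr_exp:
  fixes s u :: real
  assumes "s > 0" "u > 0"
  shows "(\<integral>\<^sup>+x\<in>{0<..}. ennreal (x powr (s - 1) * exp (- u * x)) \<partial>lborel) = ennreal (Gamma s * u powr (- s))"
proof -
  let ?f = "\<lambda>x::real. ennreal (x powr (s - 1) / exp x) * indicator {0..} x"
  have "ennreal (Gamma s) = (\<integral>\<^sup>+x. ?f x \<partial>lborel)"
    using Gamma_conv_nn_integral_real[OF assms(1)] by (simp add: mult.commute indicator_mult_ennreal)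
  also have "\<dots> = ennreal \<bar>u\<bar> * (\<integral>\<^sup>+x. ?f (0 + u * x) \<partial>lborel)"
    by (rule nn_integral_real_affine) (use assms in auto)
  also have "(\<integral>\<^sup>+x. ?f (0 + u * x) \<partial>lborel) =
      (\<integral>\<^sup>+x. ennreal (u powr (s - 1)) * (ennreal (x powr (s - 1) * exp (- u * x)) * indicator {0<..} x) \<partial>lborel)"
  proof (intro nn_integral_cong)
    fix x :: real
    show "?f (0 + u * x) = ennreal (u powr (s - 1)) * (ennreal (x powr (s - 1) * exp (- u * x)) * indicator {0<..} x)"
      using assms by (cases "x > 0")
        (auto simp: indicator_def powr_mult exp_minus field_simps zero_le_mult_iff simp flip: ennreal_mult')
  qed
  also have "\<dots> = ennreal (u powr (s - 1)) * (\<integral>\<^sup>+x\<in>{0<..}. ennreal (x powr (s - 1) * exp (- u * x)) \<partial>lborel)"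
    by (rule nn_integral_cmult) auto
  finally have "ennreal (Gamma s) = ennreal (u powr s) * (\<integral>\<^sup>+x\<in>{0<..}. ennreal (x powr (s - 1) * exp (- u * x)) \<partial>lborel)"
    (is "_ = _ * ?I") using assms by (simp add: mult.assoc[symmetric] powr_diff flip: ennreal_mult')
  then have "ennreal (u powr (-s)) * ennreal (Gamma s) = ennreal (u powr (-s) * u powr s) * ?I"
    by (simp add: mult.assoc ennreal_mult')
  also have "u powr (-s) * u powr s = 1" using assms by (simp flip: powr_add)
  finally show ?thesis by (simp add: mult.commute Gamma_real_pos assms less_imp_le flip: ennreal_mult)
qed

text \<open>The substitution y = x^2 turns the Gamma integral with parameter \<open>s/2\<close> into
  this Gaussian one.\<close>

lemma nn_integral_powr_gauss:
  fixes s u :: real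
  assumes "s > 0" "u > 0"
  shows "(\<integral>\<^sup>+x\<in>{0<..}. ennreal (x powr (s - 1) * exp (- u * x\<^sup>2)) \<partial>lborel)
    = ennreal (Gamma (s/2) * u powr (- (s/2)) / 2)"
proof -
  \<comment> \<open>This is the integrand in the variable y = x^2; multiplied by the Jacobian 2 x it
    becomes twice the wanted integrand.\<close>
  define f where "f y = y powr (s/2 - 1) * exp (- u * y)" for y :: real
  define b where "b = Gamma (s/2) * u powr (- (s/2))"
  have b0: "b \<ge> 0" unfolding b_def using assms by (simp add: Gamma_real_pos less_imp_le)
  have img: "(\<lambda>x::real. x\<^sup>2) ` {0<..} = {0<..}"
  proof (intro equalityI subsetI)
    fix y :: real assume "y \<in> {0<..}"
    then show "y \<in> (\<lambda>x. x\<^sup>2) ` {0<..}" by (intro image_eqI[of _ _ "sqrt y"]) auto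
  qed auto
  have "has_bochner_integral lborel (\<lambda>x. indicator {0<..} x * f x) b"
    using nn_integral_powr_exp[of "s/2" u] assms b0
    by (intro has_bochner_integral_nn_integral)
       (auto simp: f_def b_def indicator_mult_ennreal mult.commute split: split_indicator intro!: measurable_If)
  then have "set_integrable lborel {0<..} f" "(LINT x:{0<..}|lborel. f x) = b"
    by (auto simp: set_integrable_def set_lebesgue_integral_def has_bochner_integral_iff)
  then have 1: "f absolutely_integrable_on {0<..}" and 2: "integral {0<..} f = b"
    using set_borel_integral_eq_integral[of "{0<..}" f] by (auto simp: set_integrable_def integrable_completion)
  have "(\<lambda>x. \<bar>2 * x\<bar> * f (x\<^sup>2)) absolutely_integrable_on {0<..} \<and>
         integral {0<..} (\<lambda>x. \<bar>2 * x\<bar> * f (x\<^sup>2)) = b"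
    using 1 2 by (subst has_absolute_integral_change_of_variables_1')
      (auto simp: img inj_on_def intro!: derivative_eq_intros)
  moreover have "\<bar>2 * x\<bar> * f (x\<^sup>2) = 2 * (x powr (s - 1) * exp (- u * x\<^sup>2))" if "x \<in> {0<..}" for x
  proof -
    have "x\<^sup>2 = x powr 2" using that by simp
    then have "(x\<^sup>2) powr (s/2 - 1) = x powr (s - 2)"
      by (simp add: powr_powr algebra_simps)
    then show ?thesis using that
      by (auto simp: f_def powr_mult_base)
  qed
  ultimately have "((\<lambda>x. 2 * (x powr (s - 1) * exp (- u * x\<^sup>2))) has_integral b) {0<..}"
    by (metis (no_types, lifting) has_integral_eq integrable_integral set_lebesgue_integral_eq_integral(1))
  from has_integral_mult_right[OF this, of "1/2"]
  have "((\<lambda>x. (x powr (s - 1) * exp (- u * x\<^sup>2))) has_integral b/2) {0<..}" by simp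
  from nn_integral_has_integral_lebesgue[OF _ this] show ?thesis
    by (simp add: b_def mult.commute indicator_mult_ennreal)
qed

text \<open>Writing 1 / (1 + x^2) as the integral of exp (- u (1 + x^2)) over u > 0 and exchanging
  the integrals leaves a Gaussian integral in x and then a Gamma integral in u, whose parameter 1 -
  s/2 is positive because s < 2.\<close>

lemma nn_integral_powr_over_1_plus_square:
  fixes s :: real
  assumes "0 < s" "s < 2"
  shows "(\<integral>\<^sup>+x\<in>{0<..}. ennreal (x powr (s - 1) / (1 + x\<^sup>2)) \<partial>lborel) = ennreal (pi / (2 * sin (pi * s / 2)))"
proof -
  have *: "ennreal (x powr (s - 1) / (1 + x\<^sup>2)) * indicator {0<..} x =
    (\<integral>\<^sup>+u. ennreal (x powr (s - 1) * exp (- u * (1 + x\<^sup>2))) * indicator {0<..} u * indicator {0<..} x \<partial>lborel)" for x :: real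
  proof -
    have "1 + x\<^sup>2 > 0" by (simp add: add_pos_nonneg)
    then have "(\<integral>\<^sup>+u. ennreal (exp (- (1 + x\<^sup>2) * u)) * indicator {0<..} u \<partial>lborel) = ennreal (1 / (1 + x\<^sup>2))"
      using nn_integral_powr_exp[of 1 "1 + x\<^sup>2"]
      by (subst (asm) nn_integral_cong[of _ _ "\<lambda>u. ennreal (exp (- (1 + x\<^sup>2) * u)) * indicator {0<..} u"])
         (auto simp: powr_minus_divide indicator_def)
    then have "ennreal (x powr (s - 1) / (1 + x\<^sup>2)) * indicator {0<..} x = (ennreal (x powr (s - 1)) * indicator {0<..} x) *
       (\<integral>\<^sup>+u. ennreal (exp (- (1 + x\<^sup>2) * u)) * indicator {0<..} u \<partial>lborel)"
      by (simp add: mult.commute mult.left_commute flip: ennreal_mult')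
    also have "\<dots> = (\<integral>\<^sup>+u. (ennreal (x powr (s - 1)) * indicator {0<..} x) * (ennreal (exp (- (1 + x\<^sup>2) * u)) * indicator {0<..} u) \<partial>lborel)"
      by (rule nn_integral_cmult[symmetric]) auto
    also have "\<dots> = (\<integral>\<^sup>+u. ennreal (x powr (s - 1) * exp (- u * (1 + x\<^sup>2))) * indicator {0<..} u * indicator {0<..} x \<partial>lborel)"
      by (intro nn_integral_cong) (auto simp: indicator_def algebra_simps simp flip: ennreal_mult')
    finally show ?thesis .
  qed
  have "(\<integral>\<^sup>+x\<in>{0<..}. ennreal (x powr (s - 1) / (1 + x\<^sup>2)) \<partial>lborel) =
    (\<integral>\<^sup>+u. \<integral>\<^sup>+x. ennreal (x powr (s - 1) * exp (- u * (1 + x\<^sup>2))) * indicator {0<..} u * indicator {0<..} x \<partial>lborel \<partial>lborel)"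
    unfolding * by (rule lborel_pair.Fubini') measurable
  also have "\<dots> = (\<integral>\<^sup>+u. ennreal (Gamma (s/2) / 2) * (ennreal (u powr ((1 - s/2) - 1) * exp (- 1 * u)) * indicator {0<..} u) \<partial>lborel)"
  proof (intro nn_integral_cong)
    fix u :: real
    show "(\<integral>\<^sup>+x. ennreal (x powr (s - 1) * exp (- u * (1 + x\<^sup>2))) * indicator {0<..} u * indicator {0<..} x \<partial>lborel)
      = ennreal (Gamma (s/2) / 2) * (ennreal (u powr ((1 - s/2) - 1) * exp (- 1 * u)) * indicator {0<..} u)"
    proof (cases "u > 0")
      case True
      have "(\<integral>\<^sup>+x. ennreal (x powr (s - 1) * exp (- u * (1 + x\<^sup>2))) * indicator {0<..} u * indicator {0<..} x \<partial>lborel)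
         = (\<integral>\<^sup>+x. ennreal (exp (-u)) * (ennreal (x powr (s - 1) * exp (- u * x\<^sup>2)) * indicator {0<..} x) \<partial>lborel)"
        using True by (intro nn_integral_cong) (auto simp: indicator_def exp_add[symmetric] algebra_simps simp flip: ennreal_mult')
      also have "\<dots> = ennreal (exp (-u)) * ennreal (Gamma (s/2) * u powr (- (s/2)) / 2)"
        using nn_integral_powr_gauss[of s u] True assms by (subst nn_integral_cmult) auto
      finally show ?thesis using True assms by (simp add: mult_ac flip: ennreal_mult')
    qed auto
  qed
  also have "\<dots> = ennreal (Gamma (s/2) / 2) * ennreal (Gamma (1 - s/2))"
    using nn_integral_powr_exp[of "1 - s/2" 1] assms by (subst nn_integral_cmult) auto
  also have "\<dots> = ennreal (Gamma (s/2) * Gamma (1 - s/2) / 2)"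
    using assms by (simp add: Gamma_real_pos less_imp_le flip: ennreal_mult')
  \<comment> \<open>Euler's reflection formula at the point s/2, transferred from the complex Gamma
    function.\<close>
  also have "Gamma (s/2) * Gamma (1 - s/2) = pi / sin (pi * s / 2)"
  proof -
    have "complex_of_real (Gamma (s/2) * Gamma (1 - s/2)) = of_real (pi / sin (pi * s / 2))"
      using Gamma_reflection_complex[of "of_real (s/2)"]
      by (simp add: Gamma_complex_of_real[symmetric] sin_of_real[symmetric])
    then show ?thesis by (simp only: of_real_eq_iff)
  qed
  finally show ?thesis by (simp add: mult.commute)
qed

section \<open>The integral of (1 - cos x) x^(-k-1) in closed form\<close>

lemma nn_integral_exp_one_minus_cos:
  fixes x :: real
  shows "(\<integral>\<^sup>+l\<in>{0<..}. ennreal (exp (- l) * (1 - cos (l * x))) \<partial>lborel) = ennreal (x\<^sup>2 / (1 + x\<^sup>2))"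
proof -
  \<comment> \<open>An explicit primitive of exp (- l) (1 - cos (l x)) in l, normalised to vanish at
    infinity, so that the integral is - F 0.\<close>
  define F where "F l = exp (- l) * ((cos (l * x) - x * sin (l * x)) / (1 + x\<^sup>2) - 1)" for l
  have pos: "1 + x\<^sup>2 > 0" by (simp add: add_pos_nonneg)
  have lim: "(F \<longlongrightarrow> 0) at_top"
  proof (rule Lim_null_comparison)
    let ?B = "(1 + \<bar>x\<bar>) / (1 + x\<^sup>2) + 1"
    show "\<forall>\<^sub>F l in at_top. norm (F l) \<le> exp (- l) * ?B"
    proof (intro always_eventually allI)
      fix l
      have "\<bar>cos (l * x) - x * sin (l * x)\<bar> \<le> \<bar>cos (l * x)\<bar> + \<bar>x\<bar> * \<bar>sin (l * x)\<bar>"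
        by (metis abs_mult abs_triangle_ineq4)
      also have "\<dots> \<le> 1 + \<bar>x\<bar> * 1" by (intro add_mono mult_left_mono) auto
      finally have "\<bar>(cos (l * x) - x * sin (l * x)) / (1 + x\<^sup>2)\<bar> \<le> (1 + \<bar>x\<bar>) / (1 + x\<^sup>2)"
        using pos by (simp add: divide_right_mono)
      then have "\<bar>(cos (l * x) - x * sin (l * x)) / (1 + x\<^sup>2) - 1\<bar> \<le> ?B" by linarith
      then show "norm (F l) \<le> exp (- l) * ?B" unfolding F_def by (simp add: abs_mult)
    qed
    show "((\<lambda>l. exp (- l) * ?B) \<longlongrightarrow> 0) at_top"
      by (intro tendsto_mult_left_zero filterlim_compose[OF exp_at_bot] filterlim_uminus_at_bot_at_top)
  qed
  have "(\<integral>\<^sup>+l. ennreal (exp (- l) * (1 - cos (l * x))) * indicator {0..} l \<partial>lborel) = ennreal (0 - F 0)"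
  proof (rule nn_integral_FTC_atLeast[OF _ _ _ lim])
    fix l :: real
    define c where "c = 1 / (1 + x\<^sup>2)"
    have "c * (1 + x\<^sup>2) = 1" using pos by (simp add: c_def)
    then have "exp (- l) * cos (l * x) = exp (- l) * cos (l * x) * (c * (1 + x\<^sup>2))" by simp
    then have eq: "- exp (- l) * ((cos (l * x) - x * sin (l * x)) * c - 1)
        + exp (- l) * ((- x * sin (l * x) - x * (x * cos (l * x))) * c) = exp (- l) * (1 - cos (l * x))"
      by (simp add: algebra_simps power2_eq_square)
    have F: "F = (\<lambda>l. exp (- l) * ((cos (l * x) - x * sin (l * x)) * c - 1))"
      by (simp add: F_def c_def fun_eq_iff)
    show "(F has_real_derivative exp (- l) * (1 - cos (l * x))) (at l)"
      unfolding F eq[symmetric] by (auto intro!: derivative_eq_intros simp: algebra_simps)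
  qed auto
  moreover have "0 - F 0 = x\<^sup>2 / (1 + x\<^sup>2)" using pos by (simp add: F_def field_simps)
  moreover have "(\<integral>\<^sup>+l\<in>{0<..}. ennreal (exp (- l) * (1 - cos (l * x))) \<partial>lborel) = (\<integral>\<^sup>+l. ennreal (exp (- l) * (1 - cos (l * x))) * indicator {0..} l \<partial>lborel)"
    by (intro nn_integral_cong) (auto simp: indicator_def)
  ultimately show ?thesis by simp
qed

lemma sin_half_pi_mult_pos: "0 < k \<Longrightarrow> k < 2 \<Longrightarrow> sin (pi * k / 2) > 0" for k :: real
  by (intro sin_gt_zero) (auto simp: field_simps)

lemma nn_integral_one_minus_cos_scale:
  fixes k l :: real
  assumes assms: "l > 0"
  shows "(\<integral>\<^sup>+x\<in>{0<..}. ennreal ((1 - cos (l * x)) * x powr (- k - 1)) \<partial>lborel) =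
    ennreal (l powr k) * (\<integral>\<^sup>+x\<in>{0<..}. ennreal ((1 - cos x) * x powr (- k - 1)) \<partial>lborel)"
    (is "?L = _ * ?C")
  proof -
    have "?C = ennreal \<bar>l\<bar> * (\<integral>\<^sup>+x. ennreal ((1 - cos (0 + l * x)) * (0 + l * x) powr (- k - 1)) * indicator {0<..} (0 + l * x) \<partial>lborel)"
      by (rule nn_integral_real_affine) (use assms in auto)
    also have "(\<integral>\<^sup>+x. ennreal ((1 - cos (0 + l * x)) * (0 + l * x) powr (- k - 1)) * indicator {0<..} (0 + l * x) \<partial>lborel)
      = (\<integral>\<^sup>+x. ennreal (l powr (- k - 1)) * (ennreal ((1 - cos (l * x)) * x powr (- k - 1)) * indicator {0<..} x) \<partial>lborel)"
      using assms by (intro nn_integral_cong) (auto simp: indicator_def powr_mult zero_less_mult_iff mult_ac simp flip: ennreal_mult')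
    also have "\<dots> = ennreal (l powr (- k - 1)) * ?L"
      by (rule nn_integral_cmult) auto
    finally have "?C = ennreal (l * l powr (- k - 1)) * ?L"
      using assms by (simp add: mult.assoc ennreal_mult')
    then have "ennreal (l powr k) * ?C = ennreal (l powr k * (l * l powr (- k - 1))) * ?L"
      by (simp add: mult.assoc ennreal_mult')
    also have "l powr k * (l * l powr (- k - 1)) = 1"
      using assms by (simp add: powr_mult_base flip: powr_add)
    finally show ?thesis by simp
  qed

text \<open>Both sides are multiplied by the Gamma integral; scaling turns the product into a double
  integral whose inner integral is elementary.\<close>

lemma nn_integral_one_minus_cos_powr:
  fixes k :: real
  assumes "0 < k" "k < 2"
  shows "(\<integral>\<^sup>+x\<in>{0<..}. ennreal ((1 - cos x) * x powr (- k - 1)) \<partial>lborel)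
    = ennreal (pi / (2 * Gamma (k + 1) * sin (pi * k / 2)))"
proof -
  let ?C = "\<integral>\<^sup>+x\<in>{0<..}. ennreal ((1 - cos x) * x powr (- k - 1)) \<partial>lborel"
  let ?S = "sin (pi * k / 2)"
  have S: "?S > 0" using sin_half_pi_mult_pos assms by auto
  have G: "Gamma (k + 1) > 0" using assms by (simp add: Gamma_real_pos)
  let ?h = "\<lambda>l x. ennreal (exp (-l) * (1 - cos (l * x)) * x powr (- k - 1)) * indicator {0<..} l * indicator {0<..} x"
  have "(\<integral>\<^sup>+l. \<integral>\<^sup>+x. ?h l x \<partial>lborel \<partial>lborel) = (\<integral>\<^sup>+l. (ennreal (l powr (k + 1 - 1) * exp (- 1 * l)) * indicator {0<..} l) * ?C \<partial>lborel)"
  proof (intro nn_integral_cong)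
    fix l :: real
    have "(\<integral>\<^sup>+x. ?h l x \<partial>lborel) = (\<integral>\<^sup>+x. (ennreal (exp (-l)) * indicator {0<..} l) * (ennreal ((1 - cos (l * x)) * x powr (- k - 1)) * indicator {0<..} x) \<partial>lborel)"
      by (intro nn_integral_cong) (auto simp: indicator_def mult.assoc simp flip: ennreal_mult')
    also have "\<dots> = (ennreal (exp (-l)) * indicator {0<..} l) * (\<integral>\<^sup>+x\<in>{0<..}. ennreal ((1 - cos (l * x)) * x powr (- k - 1)) \<partial>lborel)"
      by (rule nn_integral_cmult) auto
    finally show "(\<integral>\<^sup>+x. ?h l x \<partial>lborel) = (ennreal (l powr (k + 1 - 1) * exp (- 1 * l)) * indicator {0<..} l) * ?C"
      by (cases "l > 0") (simp_all only: nn_integral_one_minus_cos_scale, auto simp: ennreal_mult' mult_ac)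
  qed
  also have "\<dots> = (\<integral>\<^sup>+l. (ennreal (l powr (k + 1 - 1) * exp (- 1 * l)) * indicator {0<..} l) \<partial>lborel) * ?C"
    by (rule nn_integral_multc) auto
  also have "\<dots> = ennreal (Gamma (k + 1)) * ?C"
    using assms by (subst nn_integral_powr_exp) auto
  also have "(\<integral>\<^sup>+l. \<integral>\<^sup>+x. ?h l x \<partial>lborel \<partial>lborel) = (\<integral>\<^sup>+x. \<integral>\<^sup>+l. ?h l x \<partial>lborel \<partial>lborel)"
    by (rule lborel_pair.Fubini'[symmetric]) measurable
  also have "\<dots> = (\<integral>\<^sup>+x\<in>{0<..}. ennreal (x powr ((2 - k) - 1) / (1 + x\<^sup>2)) \<partial>lborel)"
  proof (intro nn_integral_cong)
    fix x :: real
    have "(\<integral>\<^sup>+l. ?h l x \<partial>lborel) = (\<integral>\<^sup>+l. (ennreal (x powr (- k - 1)) * indicator {0<..} x) * (ennreal (exp (-l) * (1 - cos (l * x))) * indicator {0<..} l) \<partial>lborel)"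
      by (intro nn_integral_cong) (auto simp: indicator_def mult_ac simp flip: ennreal_mult')
    also have "\<dots> = (ennreal (x powr (- k - 1)) * indicator {0<..} x) * ennreal (x\<^sup>2 / (1 + x\<^sup>2))"
      by (subst nn_integral_cmult) (auto simp: nn_integral_exp_one_minus_cos)
    also have "\<dots> = ennreal (x powr ((2 - k) - 1) / (1 + x\<^sup>2)) * indicator {0<..} x"
    proof (cases "x > 0")
      case True
      then have "x powr (- k - 1) * x\<^sup>2 = x powr (1 - k)"
        by (simp flip: powr_numeral powr_add)
      then show ?thesis using True by (simp add: powr_numeral flip: ennreal_mult')
    qed auto
    finally show "(\<integral>\<^sup>+l. ?h l x \<partial>lborel) = ennreal (x powr ((2 - k) - 1) / (1 + x\<^sup>2)) * indicator {0<..} x" .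
  qed
  also have "\<dots> = ennreal (pi / (2 * sin (pi * (2 - k) / 2)))"
    by (rule nn_integral_powr_over_1_plus_square) (use assms in auto)
  also have "sin (pi * (2 - k) / 2) = ?S"
    by (simp add: right_diff_distrib diff_divide_distrib sin_diff)
  \<comment> \<open>Multiplying by the inverse of \<open>Gamma (k + 1)\<close> isolates
    \<open>?C\<close> inside \<open>ennreal\<close>, where its finiteness need not be known
    beforehand.\<close>
  finally have "ennreal (1 / Gamma (k + 1)) * ennreal (pi / (2 * ?S)) = ennreal (1 / Gamma (k + 1)) * (ennreal (Gamma (k + 1)) * ?C)"
    by simp
  also have "\<dots> = ?C"
    unfolding mult.assoc[symmetric] using G by (simp flip: ennreal_mult')
  finally show ?thesis using G S by (simp add: mult_ac flip: ennreal_mult')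
qed

text \<open>The integral of (1 - cos x) x^(-k-1) over x > 0, taken in closed form so that its sign
  and its behaviour under k -> k + 1 and k -> k - 1 can be read off.\<close>

definition cos_moment :: "real \<Rightarrow> real" where
  "cos_moment k = pi / (2 * Gamma (k + 1) * sin (pi * k / 2))"

lemma cos_moment_pos: "0 < k \<Longrightarrow> k < 2 \<Longrightarrow> cos_moment k > 0"
  using sin_half_pi_mult_pos[of k] Gamma_real_pos[of "k + 1"] by (simp add: cos_moment_def)

text \<open>The frequency l is kept as a parameter because the moments below are linear combinations
  of the cases l = 1 and l = 2.\<close>

lemma has_bochner_integral_one_minus_cos_powr:
  fixes k l :: real
  assumes "0 < k" "k < 2" "l > 0"
  shows "has_bochner_integral lborel (\<lambda>x. indicator {0<..} x * ((1 - cos (l * x)) * x powr (- k - 1)))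
    (l powr k * cos_moment k)"
  using nn_integral_one_minus_cos_powr[OF assms(1,2), folded cos_moment_def]
    nn_integral_one_minus_cos_scale[OF assms(3), of k] cos_moment_pos[OF assms(1,2)]
  by (intro has_bochner_integral_nn_integral)
     (auto simp: indicator_mult_ennreal mult_ac simp flip: ennreal_mult')

section \<open>Elementary bounds and the two test moments\<close>

lemma abs_sin_le_1_minus_cos_bound: "\<bar>sin x * (1 - cos x)\<bar> \<le> 1 - cos x" for x :: real
  using mult_right_mono[OF abs_sin_le_one[of x], of "1 - cos x"] by (simp add: abs_mult)

text \<open>The half-angle formula reduces this to the bound of |sin y| by |y|.\<close>

lemma one_minus_cos_le_square: "1 - cos x \<le> x\<^sup>2 / 2" for x :: real
proof -
  have "1 - cos x = 2 * (sin (x/2))\<^sup>2" using cos_double_sin[of "x/2"] by simp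
  also have "(sin (x/2))\<^sup>2 \<le> (x/2)\<^sup>2"
    using abs_sin_x_le_abs_x[of "x/2"] by (simp only: abs_le_square_iff)
  finally show ?thesis by (simp add: power2_eq_square)
qed

text \<open>For |x| at most 2 the quadratic bound suffices; beyond that 1 - cos x never exceeds
  2.\<close>

lemma one_minus_cos_le_abs: "1 - cos x \<le> \<bar>x\<bar>" for x :: real
proof (cases "\<bar>x\<bar> \<le> 2")
  case True
  then have "x\<^sup>2 \<le> \<bar>x\<bar> * 2" using mult_left_mono[of "\<bar>x\<bar>" 2 "\<bar>x\<bar>"] by (simp add: power2_eq_square)
  then show ?thesis using one_minus_cos_le_square[of x] by simp
next
  case False
  then show ?thesis using cos_ge_minus_one[of x] by linarith
qed

lemma abs_sin_mult_one_minus_cos_le: "\<bar>sin x * (1 - cos x)\<bar> \<le> \<bar>x\<bar> * (1 - cos x)" for x :: real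
  using mult_right_mono[OF abs_sin_x_le_abs_x[of x], of "1 - cos x"] by (simp add: abs_mult)

text \<open>The factor 1 - cos x makes the integrand of order x^(2-k) at 0, hence integrable for all
  0 < k < 2, whereas sin x alone would fail from k = 1 on.\<close>

definition sin_moment :: "real \<Rightarrow> real" where
  "sin_moment k = (LBINT x:{0<..}. sin x * (1 - cos x) * x powr (- k - 1))"

text \<open>The square is 2 (1 - cos x) - (1 - cos (2 x)) / 2, a combination of cosine moments at
  the frequencies 1 and 2.\<close>

lemma square_one_minus_cos_moment:
  fixes k :: real
  assumes "0 < k" "k < 2"
  shows "set_integrable lborel {0<..} (\<lambda>x. (1 - cos x)\<^sup>2 * x powr (- k - 1))"
    and "(LBINT x:{0<..}. (1 - cos x)\<^sup>2 * x powr (- k - 1)) = (2 - 2 powr (k - 1)) * cos_moment k"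
proof -
  have eq0: "(1 - cos x)\<^sup>2 = 2 * (1 - cos (1 * x)) - (1 - cos (2 * x)) / 2" for x :: real
    unfolding cos_double_cos by (simp add: power2_eq_square field_simps)
  then have eq: "indicator {0<..} x *\<^sub>R ((1 - cos x)\<^sup>2 * x powr (- k - 1)) =
      2 * (indicator {0<..} x * ((1 - cos (1 * x)) * x powr (- k - 1)))
      - (indicator {0<..} x * ((1 - cos (2 * x)) * x powr (- k - 1))) / 2" for x :: real
    by (simp only: eq0) (simp add: algebra_simps diff_divide_distrib)
  have "has_bochner_integral lborel (\<lambda>x. indicator {0<..} x *\<^sub>R ((1 - cos x)\<^sup>2 * x powr (- k - 1)))
     (2 * (1 powr k * cos_moment k) - (2 powr k * cos_moment k) / 2)"
    unfolding eq using assms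
    by (intro has_bochner_integral_diff has_bochner_integral_mult_right has_bochner_integral_divide
         has_bochner_integral_one_minus_cos_powr) auto
  moreover have "2 * (1 powr k * cos_moment k) - (2 powr k * cos_moment k) / 2 = (2 - 2 powr (k - 1)) * cos_moment k"
    by (simp add: powr_diff field_simps)
  ultimately show "set_integrable lborel {0<..} (\<lambda>x. (1 - cos x)\<^sup>2 * x powr (- k - 1))"
    and "(LBINT x:{0<..}. (1 - cos x)\<^sup>2 * x powr (- k - 1)) = (2 - 2 powr (k - 1)) * cos_moment k"
    unfolding set_integrable_def set_lebesgue_integral_def has_bochner_integral_iff by simp_all
qed

lemma set_integrable_sin_moment:
  fixes k :: real
  assumes "0 < k" "k < 2"
  shows "set_integrable lborel {0<..} (\<lambda>x. sin x * (1 - cos x) * x powr (- k - 1))"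
  unfolding set_integrable_def
proof (rule Bochner_Integration.integrable_bound)
  show "integrable lborel (\<lambda>x. indicator {0<..} x * ((1 - cos (1 * x)) * x powr (- k - 1)))"
    using has_bochner_integral_one_minus_cos_powr[of k 1] assms by (simp add: has_bochner_integral_iff)
  show "AE x in lborel. norm (indicator {0<..} x *\<^sub>R (sin x * (1 - cos x) * x powr (- k - 1)))
      \<le> norm (indicator {0<..} x * ((1 - cos (1 * x)) * x powr (- k - 1)))"
    using abs_sin_le_1_minus_cos_bound by (auto simp: indicator_def abs_mult intro!: mult_right_mono)
qed auto

section \<open>The sine moment by integration by parts\<close>

text \<open>Applied to a product \<open>F\<close>, this is integration by parts on the half-line
  with vanishing boundary terms.\<close>

lemma set_integral_deriv_Ioi_eq_0:
  fixes F f :: "real \<Rightarrow> real"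
  assumes "\<And>x. x > 0 \<Longrightarrow> (F has_real_derivative f x) (at x)" "\<And>x. x > 0 \<Longrightarrow> isCont f x"
    and "set_integrable lborel {0<..} f" "(F \<longlongrightarrow> 0) (at_right 0)" "(F \<longlongrightarrow> 0) at_top"
  shows "(LBINT x:{0<..}. f x) = 0"
proof -
  have "(LBINT x=ereal 0..\<infinity>. f x) = 0 - 0"
    using assms
    by (intro interval_integral_FTC_integrable[where F = F])
       (auto simp: has_real_derivative_iff_has_vector_derivative ereal_tendsto_simps)
  then show ?thesis by (simp add: interval_integral_to_infinity_eq)
qed

text \<open>Since sin x (1 - cos x) is the derivative of (1 - cos x)^2 / 2, integration by parts
  leads to the squared moment at k + 1. For k < 1 this index stays below 2, and the boundary term,
  of order at most x^(1-k), vanishes at 0.\<close>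

lemma sin_moment_less_1:
  fixes k :: real
  assumes "0 < k" "k < 1"
  shows "sin_moment k = (k + 1) * (1 - 2 powr (k - 1)) * cos_moment (k + 1)"
proof -
  let ?f = "\<lambda>x. sin x * (1 - cos x) * x powr (- k - 1)"
  let ?g = "\<lambda>x. (1 - cos x)\<^sup>2 * x powr (- (k + 1) - 1)"
  let ?F = "\<lambda>x. (1 - cos x)\<^sup>2 / 2 * x powr (- k - 1)"
  have f: "set_integrable lborel {0<..} ?f" using assms by (intro set_integrable_sin_moment) auto
  have g: "set_integrable lborel {0<..} ?g" "(LBINT x:{0<..}. ?g x) = (2 - 2 powr k) * cos_moment (k + 1)"
    using square_one_minus_cos_moment[of "k + 1"] assms by auto
  have "(LBINT x:{0<..}. ?f x - (k + 1) / 2 * ?g x) = 0"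
  proof (rule set_integral_deriv_Ioi_eq_0[where F = ?F])
    show "(?F has_real_derivative (?f x - (k + 1) / 2 * ?g x)) (at x)" if "x > 0" for x
    proof -
      have "(- k - 1) - 1 = - (k + 1) - 1" by simp
      then show ?thesis using that by (auto intro!: derivative_eq_intros simp: field_simps)
    qed
    show "isCont (\<lambda>x. ?f x - (k + 1) / 2 * ?g x) x" if "x > 0" for x
      using that by (auto intro!: continuous_intros)
    show "set_integrable lborel {0<..} (\<lambda>x. ?f x - (k + 1) / 2 * ?g x)"
      using f g(1) by (intro set_integral_diff(1) set_integrable_mult_right) auto
    show "(?F \<longlongrightarrow> 0) (at_right 0)"
    proof (rule Lim_null_comparison)
      show "\<forall>\<^sub>F x in at_right 0. norm (?F x) \<le> x powr (1 - k)"
      proof (rule eventually_at_right_less[THEN eventually_mono])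
        fix x :: real assume x: "0 < x"
        have "(1 - cos x)\<^sup>2 \<le> x\<^sup>2"
          using one_minus_cos_le_abs[of x] x by (intro power_mono) auto
        then have "(1 - cos x)\<^sup>2 / 2 \<le> x\<^sup>2" using zero_le_power2[of "1 - cos x"] by linarith
        then have "(1 - cos x)\<^sup>2 / 2 * x powr (- k - 1) \<le> x\<^sup>2 * x powr (- k - 1)"
          by (intro mult_right_mono) auto
        also have "\<dots> = x powr (1 - k)" using x by (simp flip: powr_numeral powr_add)
        finally show "norm (?F x) \<le> x powr (1 - k)" by (simp add: abs_mult)
      qed
      show "((\<lambda>x. x powr (1 - k)) \<longlongrightarrow> 0) (at_right 0)" using assms by real_asymp
    qed
    show "(?F \<longlongrightarrow> 0) at_top"
    proof (rule Lim_null_comparison)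
      show "\<forall>\<^sub>F x in at_top. norm (?F x) \<le> 2 * x powr (- k - 1)"
      proof (intro always_eventually allI)
        fix x :: real
        have "(1 - cos x)\<^sup>2 \<le> 2\<^sup>2" using cos_ge_minus_one[of x] by (intro power_mono) auto
        then show "norm (?F x) \<le> 2 * x powr (- k - 1)" by (auto simp: abs_mult intro!: mult_right_mono)
      qed
      show "((\<lambda>x. 2 * x powr (- k - 1)) \<longlongrightarrow> 0) at_top" using assms by real_asymp
    qed
  qed
  also have "(LBINT x:{0<..}. ?f x - (k + 1) / 2 * ?g x) = sin_moment k - (k + 1) / 2 * ((2 - 2 powr k) * cos_moment (k + 1))"
    using f g by (subst set_integral_diff(2)) (auto simp: sin_moment_def set_integrable_mult_right)
  finally show ?thesis by (simp add: powr_diff field_simps)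
qed

text \<open>Here the power is integrated and the trigonometric factor differentiated: its derivative
  is cos x - cos (2 x), which gives two cosine moments at k - 1, a positive index because k >
  1.\<close>

lemma sin_moment_greater_1:
  fixes k :: real
  assumes "1 < k" "k < 2"
  shows "k * sin_moment k = (2 powr (k - 1) - 1) * cos_moment (k - 1)"
proof -
  let ?f = "\<lambda>x. sin x * (1 - cos x) * x powr (- k - 1)"
  let ?g = "\<lambda>l x. (1 - cos (l * x)) * x powr (- (k - 1) - 1)"
  let ?F = "\<lambda>x. sin x * (1 - cos x) * x powr (- k)"
  have f: "set_integrable lborel {0<..} ?f" using assms by (intro set_integrable_sin_moment) auto
  have g: "set_integrable lborel {0<..} (?g l)" "(LBINT x:{0<..}. ?g l x) = l powr (k - 1) * cos_moment (k - 1)"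
    if "l > 0" for l
    using has_bochner_integral_one_minus_cos_powr[of "k - 1" l] assms that
    unfolding set_integrable_def set_lebesgue_integral_def has_bochner_integral_iff by auto
  have "(LBINT x:{0<..}. (?g 2 x - ?g 1 x) - k * ?f x) = 0"
  proof (rule set_integral_deriv_Ioi_eq_0[where F = ?F])
    show "(?F has_real_derivative ((?g 2 x - ?g 1 x) - k * ?f x)) (at x)" if "x > 0" for x
    proof -
      have *: "- (k - 1) - 1 = - k" by simp
      have "cos x * cos x + sin x * sin x = 1" using sin_cos_squared_add2[of x] by (simp add: power2_eq_square)
      then have "cos x * (1 - cos x) + sin x * sin x = (1 - cos (2 * x)) - (1 - cos (1 * x))"
        unfolding cos_double_cos by (simp add: power2_eq_square algebra_simps)
      then have "(?g 2 x - ?g 1 x) - k * ?f x =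
        (cos x * (1 - cos x) + sin x * sin x) * x powr (- k) + sin x * (1 - cos x) * (- k * x powr (- k - 1))"
        unfolding * by (simp only:) (simp add: algebra_simps)
      then show ?thesis using that
        by (simp only:) (auto intro!: derivative_eq_intros simp: algebra_simps)
    qed
    show "isCont (\<lambda>x. (?g 2 x - ?g 1 x) - k * ?f x) x" if "x > 0" for x
      using that by (auto intro!: continuous_intros)
    show "set_integrable lborel {0<..} (\<lambda>x. (?g 2 x - ?g 1 x) - k * ?f x)"
      using f g(1)[of 1] g(1)[of 2] by (intro set_integral_diff(1) set_integrable_mult_right) auto
    show "(?F \<longlongrightarrow> 0) (at_right 0)"
    proof (rule Lim_null_comparison)
      show "\<forall>\<^sub>F x in at_right 0. norm (?F x) \<le> x powr (2 - k)"
      proof (rule eventually_at_right_less[THEN eventually_mono])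
        fix x :: real assume x: "0 < x"
        have "\<bar>sin x * (1 - cos x)\<bar> \<le> \<bar>x\<bar> * (1 - cos x)" by (rule abs_sin_mult_one_minus_cos_le)
        also have "\<dots> \<le> \<bar>x\<bar> * \<bar>x\<bar>" by (intro mult_left_mono one_minus_cos_le_abs) auto
        finally have "norm (?F x) \<le> x\<^sup>2 * x powr (- k)"
          using x by (auto simp: abs_mult power2_eq_square intro!: mult_right_mono)
        also have "\<dots> = x powr (2 - k)" using x by (simp flip: powr_numeral powr_add)
        finally show "norm (?F x) \<le> x powr (2 - k)" .
      qed
      show "((\<lambda>x. x powr (2 - k)) \<longlongrightarrow> 0) (at_right 0)" using assms by real_asymp
    qed
    show "(?F \<longlongrightarrow> 0) at_top"
    proof (rule Lim_null_comparison)
      show "\<forall>\<^sub>F x in at_top. norm (?F x) \<le> 2 * x powr (- k)"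
      proof (intro always_eventually allI)
        fix x :: real
        have "\<bar>sin x * (1 - cos x)\<bar> \<le> 2"
          using abs_sin_le_1_minus_cos_bound[of x] cos_ge_minus_one[of x] by linarith
        then show "norm (?F x) \<le> 2 * x powr (- k)"
          unfolding real_norm_def abs_mult[of _ "x powr _"] by (intro mult_mono) auto
      qed
      show "((\<lambda>x. 2 * x powr (- k)) \<longlongrightarrow> 0) at_top" using assms by real_asymp
    qed
  qed
  also have "(LBINT x:{0<..}. (?g 2 x - ?g 1 x) - k * ?f x) =
     (2 powr (k - 1) * cos_moment (k - 1) - 1 powr (k - 1) * cos_moment (k - 1)) - k * sin_moment k"
    using f g[of 2] g[of 1] by (simp add: set_integral_diff sin_moment_def set_integrable_mult_right del: mult_1)
  finally show ?thesis by (simp add: algebra_simps)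
qed

text \<open>Both formulas involve a cosine moment with shifted index. The Gamma recursion absorbs
  the polynomial factor, and the shift of the sine by a quarter period produces the cosine in the
  denominator of the tangent.\<close>

lemma sin_moment_eq:
  fixes k :: real
  assumes "0 < k" "k < 2" "k \<noteq> 1"
  shows "sin_moment k = (1 - 2 powr (k - 1)) * tan (pi * k / 2) * cos_moment k"
proof (cases "k < 1")
  case True
  have "Gamma (k + 1 + 1) = (k + 1) * Gamma (k + 1)"
    using assms by (intro Gamma_plus1) (auto simp: nonpos_Ints_def)
  moreover have "sin (pi * (k + 1) / 2) = cos (pi * k / 2)"
    by (simp add: distrib_left add_divide_distrib sin_add)
  moreover have "Gamma (k + 1) > 0" "sin (pi * k / 2) > 0"
    using assms sin_half_pi_mult_pos[of k] by (auto simp: Gamma_real_pos)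
  ultimately show ?thesis
    using sin_moment_less_1[of k] assms True by (simp add: cos_moment_def tan_def)
next
  case False
  have "Gamma (k + 1) = k * Gamma k"
    using assms by (intro Gamma_plus1) (auto simp: nonpos_Ints_def)
  moreover have "sin (pi * (k - 1) / 2) = - cos (pi * k / 2)"
    by (simp add: right_diff_distrib diff_divide_distrib sin_diff)
  moreover have "Gamma k > 0" "sin (pi * k / 2) > 0"
    using assms sin_half_pi_mult_pos[of k] by (auto simp: Gamma_real_pos)
  \<comment> \<open>This says that \<open>cos (pi * k / 2)\<close> is negative, so clearing the
    denominators is legitimate.\<close>
  moreover have "sin (pi * (k - 1) / 2) > 0"
    using assms False by (intro sin_half_pi_mult_pos) auto
  ultimately have "k * sin_moment k = k * ((1 - 2 powr (k - 1)) * tan (pi * k / 2) * cos_moment k)"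
    using sin_moment_greater_1[of k] assms False by (simp add: cos_moment_def tan_def divide_simps) (auto simp: algebra_simps split: if_splits)
  then show ?thesis using assms by simp
qed

section \<open>Weak convergence of the weighted laws\<close>

text \<open>The cosine is even and decreasing on the interval from 0 to pi, which contains
  2.\<close>

lemma one_minus_cos_ge_on_shell:
  fixes y :: real
  assumes "1 \<le> \<bar>y\<bar>" "\<bar>y\<bar> \<le> 2"
  shows "1 - cos 1 \<le> 1 - cos y"
  using cos_monotone_0_pi_le[of 1 "\<bar>y\<bar>"] assms pi_ge_two by simp

lemma one_minus_cos_1_pos: "1 - cos (1 :: real) > 0"
  using cos_monotone_0_pi[of 0 1] pi_gt3 by simp

text \<open>With cos u as the half-sum of two exponentials, the weight 1 - cos u acts on characters
  as a second difference in l.\<close>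

lemma one_minus_cos_mult_iexp:
  fixes l u :: real
  shows "complex_of_real (1 - cos u) * iexp (l * u) =
     iexp (l * u) - (iexp ((l + 1) * u) + iexp ((l - 1) * u)) / 2"
proof -
  have "iexp ((l + 1) * u) = iexp (l * u) * iexp u" "iexp ((l - 1) * u) = iexp (l * u) * iexp (- u)"
    by (simp_all add: exp_add[symmetric] algebra_simps)
  moreover have "complex_of_real (cos u) = (iexp u + iexp (- u)) / 2"
    by (simp add: cos_of_real[symmetric] cos_exp_eq)
  ultimately show ?thesis by (simp add: algebra_simps add_divide_distrib)
qed

section \<open>Behaviour of the characteristic function near 0\<close>

text \<open>Only right tails are studied inside the locale; the left tail is obtained by
  interpreting it again with - X and - c.\<close>

locale cf_reg_var = prob_space M for M :: "'a measure" +
  fixes X :: "'a \<Rightarrow> real" and k c :: real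
  assumes X_measurable [measurable]: "X \<in> borel_measurable M"
    and k_pos: "0 < k" and k_less_2: "k < 2"
    and reg_var: "regularly_varying_at_0 (\<lambda>t. 1 - cf_U M X t) k"
    and V_over_g: "((\<lambda>t. cf_V M X t / (1 - cf_U M X t)) \<longlongrightarrow> c) (at_right 0)"
begin

definition g :: "real \<Rightarrow> real" where "g t = 1 - cf_U M X t"

lemma integrable_bounded:
  fixes f :: "real \<Rightarrow> 'b :: {banach, second_countable_topology}"
  assumes "f \<in> borel_measurable borel" "\<And>x. norm (f x) \<le> B"
  shows "integrable M (\<lambda>\<omega>. f (t * X \<omega>))"
  by (rule integrable_const_bound[where B = B]) (use assms in auto)

lemma g_eq: "g t = expectation (\<lambda>\<omega>. 1 - cos (t * X \<omega>))"
  unfolding g_def cf_U_def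
  by (subst Bochner_Integration.integral_diff) (auto intro!: integrable_bounded[where B = 1] simp: prob_space)

lemma g_nonneg: "g t \<ge> 0"
  unfolding g_eq by (intro integral_nonneg_AE) auto

lemma g_minus [simp]: "g (- t) = g t"
  by (simp add: g_eq)

lemma g_0 [simp]: "g 0 = 0"
  by (simp add: g_eq)

lemma V_minus: "cf_V M X (- t) = - cf_V M X t"
  by (simp add: cf_V_def)

lemma V_0 [simp]: "cf_V M X 0 = 0"
  by (simp add: cf_V_def)

lemma g_scale: "l > 0 \<Longrightarrow> ((\<lambda>t. g (l * t) / g t) \<longlongrightarrow> l powr k) (at_right 0)"
  using reg_var by (simp add: regularly_varying_at_0_def g_def)

text \<open>The quotient g t / g t tends to 1, but would be 0 wherever \<open>g t\<close> vanished;
  nonnegativity does the rest.\<close>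

lemma eventually_g_pos: "\<forall>\<^sub>F t in at_right 0. g t > 0"
proof -
  have "\<forall>\<^sub>F t in at_right 0. g (1 * t) / g t > 0"
    using order_tendstoD(1)[OF g_scale[of 1], of 0] by simp
  then show ?thesis
    by eventually_elim (use g_nonneg in \<open>auto simp: less_le\<close>)
qed

lemma filterlim_scale_at_right_0: "l > 0 \<Longrightarrow> filterlim (\<lambda>t. l * t) (at_right 0) (at_right (0::real))" for l :: real
  using filterlim_times_pos[OF filterlim_ident, of l 0 0] by (simp add: mult.commute)

text \<open>The quotient is factored through \<open>g (l * t)\<close>, combining the hypothesis on V
  with regular variation.\<close>

lemma V_scale:
  assumes "l > 0"
  shows "((\<lambda>t. cf_V M X (l * t) / g t) \<longlongrightarrow> c * l powr k) (at_right 0)"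
proof -
  have "((\<lambda>t. (cf_V M X (l * t) / g (l * t)) * (g (l * t) / g t)) \<longlongrightarrow> c * l powr k) (at_right 0)"
    using filterlim_compose[OF V_over_g filterlim_scale_at_right_0[OF assms]]
    by (intro tendsto_mult g_scale assms) (simp add: g_def)
  moreover have "\<forall>\<^sub>F t in at_right 0. g (l * t) > 0"
    using filterlim_scale_at_right_0[OF assms] eventually_g_pos by (auto simp: filterlim_iff)
  then have "\<forall>\<^sub>F t in at_right 0. (cf_V M X (l * t) / g (l * t)) * (g (l * t) / g t) = cf_V M X (l * t) / g t"
    by eventually_elim auto
  ultimately show ?thesis by (rule Lim_transform_eventually)
qed

text \<open>The limit of one minus the characteristic function at l t, divided by
  \<open>g t\<close>. Its real part is even in l and its imaginary part odd; both vanish at l =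
  0.\<close>

definition psi :: "real \<Rightarrow> complex" where
  "psi l = Complex (\<bar>l\<bar> powr k) (- (sgn l * c * \<bar>l\<bar> powr k))"

lemma psi_limit:
  "((\<lambda>t. (1 - (CLINT \<omega>|M. iexp (l * t * X \<omega>))) / g t) \<longlongrightarrow> psi l) (at_right 0)"
proof -
  have char: "(CLINT \<omega>|M. iexp (s * X \<omega>)) = Complex (cf_U M X s) (cf_V M X s)" for s
  proof -
    have "char (distr M borel X) s = (CLINT \<omega>|M. iexp (s * X \<omega>))"
      unfolding char_def by (subst integral_distr) auto
    then show ?thesis using char_eq_cf_U_cf_V[OF X_measurable, of s] by simp
  qed
  have eq: "(1 - (CLINT \<omega>|M. iexp (l * t * X \<omega>))) / g t = Complex (g (l * t) / g t) (- (cf_V M X (l * t) / g t))" for t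
    unfolding char by (simp add: complex_eq_iff Re_divide_of_real Im_divide_of_real g_def)
  have "((\<lambda>t. g (l * t) / g t) \<longlongrightarrow> \<bar>l\<bar> powr k) (at_right 0) \<and>
      ((\<lambda>t. cf_V M X (l * t) / g t) \<longlongrightarrow> sgn l * c * \<bar>l\<bar> powr k) (at_right 0)"
  proof (cases l "0::real" rule: linorder_cases)
    case less
    then have "g (l * t) = g (- l * t)" "cf_V M X (l * t) = - cf_V M X (- l * t)" for t
      using g_minus[of "l * t"] V_minus[of "l * t"] by simp_all
    then show ?thesis using less g_scale[of "- l"] V_scale[of "- l"]
      by (auto intro: tendsto_minus)
  next
    case equal
    then show ?thesis by simp
  next
    case greater
    then show ?thesis using g_scale[of l] V_scale[of l] by simp
  qed
  then show ?thesis unfolding eq psi_def by (intro tendsto_Complex tendsto_minus) auto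
qed

text \<open>Markov's inequality for the variable 1 - cos (t X), which is at least 1 - cos 1 on the
  shell.\<close>

lemma prob_shell_le: "prob {\<omega> \<in> space M. 1 < \<bar>t * X \<omega>\<bar> \<and> \<bar>t * X \<omega>\<bar> \<le> 2} \<le> g t / (1 - cos 1)"
proof -
  let ?A = "{\<omega> \<in> space M. 1 < \<bar>t * X \<omega>\<bar> \<and> \<bar>t * X \<omega>\<bar> \<le> 2}"
  have int: "integrable M (indicat_real ?A)" by (rule integrable_real_indicator) (auto simp: less_top[symmetric])
  have "(1 - cos 1) * prob ?A = expectation (\<lambda>\<omega>. (1 - cos 1) * indicator ?A \<omega>)" by simp
  also have "\<dots> \<le> g t" unfolding g_eq
    using one_minus_cos_ge_on_shell
    by (intro integral_mono integrable_bounded[where B = 2 and f = "\<lambda>x. 1 - cos x"] integrable_mult_right int)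
       (auto simp: indicator_def intro: abs_triangle_ineq4[THEN order_trans] add_mono[of _ 1 _ 1, simplified])
  finally show ?thesis using one_minus_cos_1_pos by (simp add: field_simps)
qed

section \<open>Geometric bounds for the tails\<close>

text \<open>The constants are bundled because one choice of them has to serve all n and all small t
  at once.\<close>

definition dyadic_tail_bound :: "real \<Rightarrow> real \<Rightarrow> real \<Rightarrow> bool" where
  "dyadic_tail_bound t0 \<rho> C \<longleftrightarrow> t0 > 0 \<and> 0 < \<rho> \<and> \<rho> < 1 \<and> C > 0 \<and>
     (\<forall>t. 0 < t \<longrightarrow> t \<le> t0 \<longrightarrow> g t > 0 \<and>
       (\<forall>n. prob {\<omega> \<in> space M. 2 ^ n < \<bar>t * X \<omega>\<bar>} \<le> C * \<rho> ^ n * g t))"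

lemma dyadic_tail_bound_exists: "\<exists>t0 \<rho> C. dyadic_tail_bound t0 \<rho> C"
proof -
  have "(1/2) powr k < 1" using gr_one_powr[of 2 k] k_pos by (simp add: powr_divide)
  \<comment> \<open>Halving t multiplies g asymptotically by (1/2)^k; any \<rho> strictly above this
    value bounds the ratio for all small t.\<close>
  then obtain \<rho> where \<rho>: "(1/2) powr k < \<rho>" "\<rho> < 1" using dense by blast
  then have \<rho>0: "0 < \<rho>" using powr_ge_zero[of "1/2" k] by linarith
  have "\<forall>\<^sub>F t in at_right 0. g (1/2 * t) / g t < \<rho>"
    using order_tendstoD(2)[OF g_scale[of "1/2"]] \<rho> by simp
  with eventually_g_pos have "\<forall>\<^sub>F t in at_right 0. g t > 0 \<and> g (t / 2) \<le> \<rho> * g t"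
    by eventually_elim (auto simp: field_simps)
  then obtain b where b: "b > 0" "\<And>t. 0 < t \<Longrightarrow> t < b \<Longrightarrow> g t > 0 \<and> g (t / 2) \<le> \<rho> * g t"
    by (auto simp: eventually_at_right_field)
  define t0 where "t0 = b / 2"
  have t0: "t0 > 0" "\<And>t. 0 < t \<Longrightarrow> t \<le> t0 \<Longrightarrow> g t > 0 \<and> g (t / 2) \<le> \<rho> * g t"
    using b by (auto simp: t0_def)
  have pow: "g (t / 2 ^ n) \<le> \<rho> ^ n * g t" if "0 < t" "t \<le> t0" for t n
  proof (induction n)
    case (Suc n)
    have "t / 2 ^ n \<le> t0" using divide_left_mono[of 1 "2 ^ n" t] that by simp
    then have "g (t / 2 ^ n / 2) \<le> \<rho> * g (t / 2 ^ n)" using t0(2)[of "t / 2 ^ n"] that by simp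
    also have "\<dots> \<le> \<rho> * (\<rho> ^ n * g t)" using Suc \<rho>0 by simp
    finally show ?case by (simp add: mult_ac)
  qed simp
  \<comment> \<open>The shell constant times the sum of the geometric series in \<rho>.\<close>
  define C where "C = 1 / ((1 - cos 1) * (1 - \<rho>))"
  have C: "C > 0" using \<rho> one_minus_cos_1_pos by (simp add: C_def)
  have one: "prob {\<omega> \<in> space M. 1 < \<bar>t * X \<omega>\<bar>} \<le> C * g t" if t: "0 < t" "t \<le> t0" for t
  proof -
    let ?B = "\<lambda>n::nat. {\<omega> \<in> space M. 2 ^ n < \<bar>t * X \<omega>\<bar>}"
    \<comment> \<open>The shells from 2^N to 2^(N+1) are peeled off one at a time; the remaining
      event decreases to the empty set.\<close>
    have "prob (?B 0) \<le> (\<Sum>m<N. \<rho> ^ m * (g t / (1 - cos 1))) + prob (?B N)" for N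
    proof (induction N)
      case (Suc N)
      have "?B N \<subseteq> {\<omega> \<in> space M. 1 < \<bar>t / 2 ^ N * X \<omega>\<bar> \<and> \<bar>t / 2 ^ N * X \<omega>\<bar> \<le> 2} \<union> ?B (Suc N)"
        by (auto simp: abs_mult field_simps)
      then have "prob (?B N) \<le> prob ({\<omega> \<in> space M. 1 < \<bar>t / 2 ^ N * X \<omega>\<bar> \<and> \<bar>t / 2 ^ N * X \<omega>\<bar> \<le> 2} \<union> ?B (Suc N))"
        by (intro finite_measure_mono) auto
      also have "\<dots> \<le> prob {\<omega> \<in> space M. 1 < \<bar>t / 2 ^ N * X \<omega>\<bar> \<and> \<bar>t / 2 ^ N * X \<omega>\<bar> \<le> 2} + prob (?B (Suc N))"
        by (intro measure_Un_le) auto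
      also have "prob {\<omega> \<in> space M. 1 < \<bar>t / 2 ^ N * X \<omega>\<bar> \<and> \<bar>t / 2 ^ N * X \<omega>\<bar> \<le> 2} \<le> g (t / 2 ^ N) / (1 - cos 1)"
        by (rule prob_shell_le)
      also have "\<dots> \<le> \<rho> ^ N * g t / (1 - cos 1)"
        using pow[OF t] one_minus_cos_1_pos by (intro divide_right_mono) auto
      finally show ?case using Suc by simp
    qed simp
    moreover have "(\<Sum>m<N. \<rho> ^ m * (g t / (1 - cos 1))) \<le> C * g t" for N
    proof -
      have "(\<Sum>m<N. \<rho> ^ m) \<le> 1 / (1 - \<rho>)"
        using \<rho> \<rho>0 sum_le_suminf[of "\<lambda>m. \<rho> ^ m" "{..<N}"] by (simp add: suminf_geometric summable_geometric)
      then have "(\<Sum>m<N. \<rho> ^ m) * (g t / (1 - cos 1)) \<le> 1 / (1 - \<rho>) * (g t / (1 - cos 1))"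
        using g_nonneg one_minus_cos_1_pos by (intro mult_right_mono) auto
      then show ?thesis unfolding sum_distrib_right[symmetric] C_def by (simp add: mult_ac)
    qed
    ultimately have le: "prob (?B 0) \<le> C * g t + prob (?B N)" for N
      by (meson add_mono order_refl order_trans)
    have "(\<lambda>N. prob (?B N)) \<longlonglongrightarrow> prob (\<Inter>N. ?B N)"
    proof (rule finite_Lim_measure_decseq)
      show "decseq ?B"
        by (auto simp: decseq_def intro: le_less_trans[OF power_increasing])
    qed auto
    moreover have "(\<Inter>N. ?B N) = {}"
    proof -
      have "\<exists>N. \<bar>t * X \<omega>\<bar> < 2 ^ N" for \<omega> using real_arch_pow[of 2] by simp
      then show ?thesis by (auto simp: not_less_iff_gr_or_eq) (metis not_less_iff_gr_or_eq)
    qed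
    ultimately have "(\<lambda>N. C * g t + prob (?B N)) \<longlonglongrightarrow> C * g t + 0"
      by (intro tendsto_add) auto
    then have "prob (?B 0) \<le> C * g t + 0" by (rule LIMSEQ_le_const) (use le in auto)
    then show ?thesis by simp
  qed
  \<comment> \<open>The event for n at scale t is the event for n = 0 at scale t / 2^n, so the case
    just proved applies.\<close>
  have "prob {\<omega> \<in> space M. 2 ^ n < \<bar>t * X \<omega>\<bar>} \<le> C * \<rho> ^ n * g t" if t: "0 < t" "t \<le> t0" for t and n :: nat
  proof -
    have "t / 2 ^ n \<le> t0" using divide_left_mono[of 1 "2 ^ n" t] that by simp
    then have "prob {\<omega> \<in> space M. 1 < \<bar>t / 2 ^ n * X \<omega>\<bar>} \<le> C * g (t / 2 ^ n)" using t by (intro one) auto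
    also have "\<dots> \<le> C * (\<rho> ^ n * g t)" using pow[OF t] C by simp
    finally show ?thesis by (simp add: abs_mult field_simps)
  qed
  then have "dyadic_tail_bound t0 \<rho> C" unfolding dyadic_tail_bound_def using t0 \<rho> \<rho>0 C by auto
  then show ?thesis by blast
qed

section \<open>The weighted laws and their weak limit\<close>

text \<open>Dividing by \<open>g t\<close> normalises the total mass to 1 as soon as
  \<open>g t\<close> is positive.\<close>

definition weighted_law :: "real \<Rightarrow> real measure" where
  "weighted_law t = distr (density M (\<lambda>\<omega>. ennreal ((1 - cos (t * X \<omega>)) / g t))) borel (\<lambda>\<omega>. t * X \<omega>)"

lemma integral_weighted_law:
  fixes f :: "real \<Rightarrow> 'b :: {banach, second_countable_topology}"
  assumes [measurable]: "f \<in> borel_measurable borel"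
  shows "integral\<^sup>L (weighted_law t) f = (\<integral>\<omega>. ((1 - cos (t * X \<omega>)) / g t) *\<^sub>R f (t * X \<omega>) \<partial>M)"
  unfolding weighted_law_def
  by (subst integral_distr, simp, simp, subst integral_density) (auto simp: g_nonneg)

lemma real_distribution_weighted_law:
  assumes "g t > 0"
  shows "real_distribution (weighted_law t)"
proof -
  have "(\<integral>\<^sup>+\<omega>. ennreal ((1 - cos (t * X \<omega>)) / g t) \<partial>M) = ennreal (expectation (\<lambda>\<omega>. (1 - cos (t * X \<omega>)) / g t))"
    by (intro nn_integral_eq_integral integrable_bounded[where B = "2 / g t" and f = "\<lambda>x. (1 - cos x) / g t"])
       (auto simp: g_nonneg intro!: divide_right_mono abs_triangle_ineq4[THEN order_trans] add_mono[of _ 1 _ 1, simplified])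
  also have "expectation (\<lambda>\<omega>. (1 - cos (t * X \<omega>)) / g t) = 1"
    using assms g_eq[of t] by simp
  finally have "prob_space (density M (\<lambda>\<omega>. ennreal ((1 - cos (t * X \<omega>)) / g t)))"
    by (intro prob_spaceI) (auto simp: emeasure_density cong: nn_integral_cong)
  then show ?thesis unfolding weighted_law_def
    by (intro prob_space.real_distribution_distr) auto
qed

text \<open>A second difference annihilates constants, so each exponential may be replaced by its
  difference from 1, the form in which \<open>psi_limit\<close> applies.\<close>

lemma char_weighted_law:
  "char (weighted_law t) l = ((1 - (CLINT \<omega>|M. iexp ((l + 1) * t * X \<omega>))) / g t + (1 - (CLINT \<omega>|M. iexp ((l - 1) * t * X \<omega>))) / g t) / 2
     - (1 - (CLINT \<omega>|M. iexp (l * t * X \<omega>))) / g t"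
proof -
  have alg: "(x - (y + z) / 2) / w = ((1 - y) / w + (1 - z) / w) / 2 - (1 - x) / w" for x y z w :: complex
    by (simp add: diff_divide_distrib add_divide_distrib mult.commute)
  have int: "integrable M (\<lambda>\<omega>. iexp (l * t * X \<omega>))" for l
    using integrable_bounded[of "\<lambda>x. iexp x" 1 "l * t"] by simp
  have "char (weighted_law t) l = (CLINT \<omega>|M. (iexp (l * t * X \<omega>) - (iexp ((l + 1) * t * X \<omega>) + iexp ((l - 1) * t * X \<omega>)) / 2) / g t)"
    unfolding char_def
  proof (subst integral_weighted_law)
    show "(CLINT \<omega>|M. ((1 - cos (t * X \<omega>)) / g t) *\<^sub>R iexp (l * (t * X \<omega>))) = (CLINT \<omega>|M. (iexp (l * t * X \<omega>) - (iexp ((l + 1) * t * X \<omega>) + iexp ((l - 1) * t * X \<omega>)) / 2) / g t)"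
      using one_minus_cos_mult_iexp[of "t * X _" l]
      by (intro Bochner_Integration.integral_cong) (auto simp: scaleR_conv_of_real mult.assoc)
  qed simp
  also have "\<dots> = ((CLINT \<omega>|M. iexp (l * t * X \<omega>)) - ((CLINT \<omega>|M. iexp ((l + 1) * t * X \<omega>)) + (CLINT \<omega>|M. iexp ((l - 1) * t * X \<omega>))) / 2) / g t"
    using int[of l] int[of "l + 1"] int[of "l - 1"] by simp
  also have "\<dots> = ((1 - (CLINT \<omega>|M. iexp ((l + 1) * t * X \<omega>))) / g t + (1 - (CLINT \<omega>|M. iexp ((l - 1) * t * X \<omega>))) / g t) / 2
     - (1 - (CLINT \<omega>|M. iexp (l * t * X \<omega>))) / g t"
    by (rule alg)
  finally show ?thesis .
qed

lemma char_weighted_law_limit: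
  "((\<lambda>t. char (weighted_law t) l) \<longlongrightarrow> (psi (l + 1) + psi (l - 1)) / 2 - psi l) (at_right 0)"
  unfolding char_weighted_law by (intro tendsto_intros psi_limit) auto

text \<open>The density is at most 2 / g t, which cancels the factor \<open>g t\<close> of the tail
  bound and leaves an estimate uniform in t.\<close>

lemma measure_weighted_law_le:
  assumes "dyadic_tail_bound t0 \<rho> C" "0 < t" "t \<le> t0"
  shows "measure (weighted_law t) {x. 2 ^ n < \<bar>x\<bar>} \<le> 2 * C * \<rho> ^ n"
proof -
  have g: "g t > 0" and tl: "prob {\<omega> \<in> space M. 2 ^ n < \<bar>t * X \<omega>\<bar>} \<le> C * \<rho> ^ n * g t"
    using assms unfolding dyadic_tail_bound_def by auto
  interpret W: real_distribution "weighted_law t" by (rule real_distribution_weighted_law[OF g])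
  let ?A = "{\<omega> \<in> space M. 2 ^ n < \<bar>t * X \<omega>\<bar>}"
  have "measure (weighted_law t) {x. 2 ^ n < \<bar>x\<bar>} = integral\<^sup>L (weighted_law t) (indicat_real {x. 2 ^ n < \<bar>x\<bar>})"
    by simp
  also have "\<dots> = expectation (\<lambda>\<omega>. ((1 - cos (t * X \<omega>)) / g t) *\<^sub>R indicator {x. 2 ^ n < \<bar>x\<bar>} (t * X \<omega>))"
    by (rule integral_weighted_law) measurable
  also have "\<dots> \<le> expectation (\<lambda>\<omega>. 2 / g t * indicator ?A \<omega>)"
  proof (rule integral_mono)
    show "integrable M (\<lambda>\<omega>. 2 / g t * indicat_real ?A \<omega>)"
      by (intro integrable_mult_right integrable_real_indicator) (auto simp: less_top[symmetric])
    show "integrable M (\<lambda>\<omega>. ((1 - cos (t * X \<omega>)) / g t) *\<^sub>R indicat_real {x. 2 ^ n < \<bar>x\<bar>} (t * X \<omega>))"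
      by (rule integrable_bounded[where B = "2 / g t"])
         (use g in \<open>auto simp: indicator_def intro!: divide_right_mono abs_triangle_ineq4[THEN order_trans] add_mono[of _ 1 _ 1, simplified]\<close>)
    fix \<omega> assume "\<omega> \<in> space M"
    then show "((1 - cos (t * X \<omega>)) / g t) *\<^sub>R indicat_real {x. 2 ^ n < \<bar>x\<bar>} (t * X \<omega>) \<le> 2 / g t * indicator ?A \<omega>"
      using g cos_ge_minus_one[of "t * X \<omega>"] by (auto simp: indicator_def intro!: divide_right_mono)
  qed
  also have "\<dots> = 2 / g t * prob ?A" by simp
  also have "\<dots> \<le> 2 / g t * (C * \<rho> ^ n * g t)" using g tl by (intro mult_left_mono) auto
  also have "\<dots> = 2 * C * \<rho> ^ n" using g by simp
  finally show ?thesis .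
qed

text \<open>The pointwise limit of the characteristic functions must be shown to be one itself.
  Tightness along a sequence tending to 0 yields a weakly convergent subsequence, and its limit has
  the required characteristic function.\<close>

lemma limit_law_exists:
  "\<exists>\<mu>. real_distribution \<mu> \<and> (\<forall>l. char \<mu> l = (psi (l + 1) + psi (l - 1)) / 2 - psi l)"
proof -
  obtain t0 \<rho> C where tc: "dyadic_tail_bound t0 \<rho> C" using dyadic_tail_bound_exists by blast
  then have t0: "t0 > 0" and \<rho>: "0 < \<rho>" "\<rho> < 1" and C: "C > 0" and gpos: "\<And>t. 0 < t \<Longrightarrow> t \<le> t0 \<Longrightarrow> g t > 0"
    by (auto simp: dyadic_tail_bound_def)
  define s where "s n = t0 / real (Suc n)" for n
  have s: "0 < s n" "s n \<le> t0" for n using t0 by (auto simp: s_def field_simps)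
  have s_lim: "filterlim s (at_right 0) sequentially"
    unfolding s_def using t0 by real_asymp
  have rd: "real_distribution (weighted_law (s n))" for n
    by (intro real_distribution_weighted_law gpos s)
  have "tight (\<lambda>n. weighted_law (s n))"
    unfolding tight_def
  proof (intro conjI allI impI rd)
    fix \<epsilon> :: real assume "\<epsilon> > 0"
    have "(\<lambda>n. 2 * C * \<rho> ^ n) \<longlonglongrightarrow> 0" using \<rho> by (intro tendsto_mult_right_zero LIMSEQ_power_zero) auto
    from order_tendstoD(2)[OF this \<open>\<epsilon> > 0\<close>] obtain n where n: "2 * C * \<rho> ^ n < \<epsilon>"
      by (auto simp: eventually_sequentially)
    show "\<exists>a b. a < b \<and> (\<forall>m. measure (weighted_law (s m)) {a<..b} > 1 - \<epsilon>)"
    \<comment> \<open>The doubled radius absorbs the left endpoint, which the half-open interval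
      omits while the tail event is strict.\<close>
    proof (rule exI[of _ "- (2 ^ (n + 1))"], rule exI[of _ "2 ^ (n + 1)"], intro conjI allI)
      fix m
      interpret W: real_distribution "weighted_law (s m)" by (rule rd)
      have "W.prob (- {- (2 ^ (n + 1))<..2 ^ (n + 1)}) \<le> W.prob {x. 2 ^ n < \<bar>x\<bar>}"
      proof (rule W.finite_measure_mono)
        show "- {- (2 ^ (n + 1))<..2 ^ (n + 1)} \<subseteq> {x::real. 2 ^ n < \<bar>x\<bar>}"
        proof
          fix x :: real assume "x \<in> - {- (2 ^ (n + 1))<..2 ^ (n + 1)}"
          then have "x \<le> - (2 * 2 ^ n) \<or> 2 * 2 ^ n < x" by auto
          moreover have "(0::real) < 2 ^ n" by simp
          ultimately have "2 ^ n < \<bar>x\<bar>" by linarith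
          then show "x \<in> {x. 2 ^ n < \<bar>x\<bar>}" by simp
        qed
      qed auto
      also have "\<dots> < \<epsilon>" using measure_weighted_law_le[OF tc s(1)[of m] s(2)[of m], of n] n by (rule le_less_trans)
      finally show "1 - \<epsilon> < W.prob {- (2 ^ (n + 1))<..2 ^ (n + 1)}"
        using W.prob_compl[of "{- (2 ^ (n + 1))<..2 ^ (n + 1)}"] by (simp add: Compl_eq_Diff_UNIV)
    qed (simp add: less_trans[of _ 0])
  qed
  from tight_imp_convergent_subsubsequence[OF this strict_mono_id] obtain r \<mu> where
    r: "strict_mono (r :: nat \<Rightarrow> nat)" "real_distribution \<mu>" "weak_conv_m (\<lambda>n. weighted_law (s (r n))) \<mu>"
    by (auto simp: comp_def)
  have "char \<mu> l = (psi (l + 1) + psi (l - 1)) / 2 - psi l" for l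
  proof (rule LIMSEQ_unique)
    show "(\<lambda>n. char (weighted_law (s (r n))) l) \<longlonglongrightarrow> char \<mu> l"
      using rd r by (intro levy_continuity1) auto
    show "(\<lambda>n. char (weighted_law (s (r n))) l) \<longlonglongrightarrow> (psi (l + 1) + psi (l - 1)) / 2 - psi l"
      using filterlim_compose[OF s_lim filterlim_subseq[OF r(1)]]
      by (rule filterlim_compose[OF char_weighted_law_limit])
  qed
  with r show ?thesis by blast
qed

definition limit_law :: "real measure" where
  "limit_law = (SOME \<mu>. real_distribution \<mu> \<and> (\<forall>l. char \<mu> l = (psi (l + 1) + psi (l - 1)) / 2 - psi l))"

lemma limit_law: "real_distribution limit_law" "char limit_law l = (psi (l + 1) + psi (l - 1)) / 2 - psi l"
  using someI_ex[OF limit_law_exists] by (auto simp: limit_law_def)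

text \<open>On every sequence decreasing to 0 within the range where \<open>weighted_law\<close> is
  a probability, Levy's continuity theorem gives weak convergence, which extends to bounded
  functions continuous almost everywhere.\<close>

lemma weak_limit:
  fixes f :: "real \<Rightarrow> real"
  assumes "emeasure limit_law {x. \<not> isCont f x} = 0" "\<And>x. norm (f x) \<le> B" "f \<in> borel_measurable borel"
  shows "((\<lambda>t. integral\<^sup>L (weighted_law t) f) \<longlongrightarrow> integral\<^sup>L limit_law f) (at_right 0)"
proof -
  obtain t0 \<rho> C where tc: "dyadic_tail_bound t0 \<rho> C" using dyadic_tail_bound_exists by blast
  then have t0: "t0 > 0" and gpos: "\<And>t. 0 < t \<Longrightarrow> t \<le> t0 \<Longrightarrow> g t > 0"
    by (auto simp: dyadic_tail_bound_def)
  show ?thesis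
  proof (rule tendsto_at_right_sequentially[OF t0])
    fix S :: "nat \<Rightarrow> real" assume S: "\<And>n. 0 < S n" "\<And>n. S n < t0" "S \<longlonglongrightarrow> 0"
    have rd: "real_distribution (weighted_law (S n))" for n
      using S by (intro real_distribution_weighted_law gpos) (auto intro: less_imp_le)
    have "filterlim S (at_right 0) sequentially"
      using S by (intro tendsto_imp_filterlim_at_right) auto
    then have "weak_conv_m (\<lambda>n. weighted_law (S n)) limit_law"
      using rd limit_law(1) by (intro levy_continuity) (auto simp: limit_law(2) intro: filterlim_compose[OF char_weighted_law_limit])
    then show "(\<lambda>n. integral\<^sup>L (weighted_law (S n)) f) \<longlonglongrightarrow> integral\<^sup>L limit_law f"
      using rd limit_law(1) assms by (intro weak_conv_imp_bdd_ae_continuous_conv) auto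
  qed
qed

end

section \<open>Regular variation of the tails\<close>

text \<open>The only candidate is the fixed point of p = m + q p. The deviation from it is
  contracted at each halving by a factor below 1 up to a small error, and boundedness makes the
  contribution of the starting value disappear.\<close>

lemma tendsto_halving_recursion:
  fixes \<tau> h d :: "real \<Rightarrow> real"
  assumes d: "(d \<longlongrightarrow> m) (at_right 0)" and h: "(h \<longlongrightarrow> q) (at_right 0)" and q: "0 \<le> q" "q < 1"
    and bounded: "\<forall>\<^sub>F t in at_right 0. \<bar>\<tau> t\<bar> \<le> B"
    and rec: "\<forall>\<^sub>F t in at_right 0. \<tau> t = d t + h t * \<tau> (t / 2)"
  shows "(\<tau> \<longlongrightarrow> m / (1 - q)) (at_right 0)"
proof -
  define p where "p = m / (1 - q)"
  have p: "p = m + q * p" using q by (simp add: p_def field_simps)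
  obtain r where r: "q < r" "r < 1" using dense[OF q(2)] by blast
  have "((\<lambda>t. (d t - m) + (h t - q) * p) \<longlongrightarrow> (m - m) + (q - q) * p) (at_right 0)"
    by (intro tendsto_intros d h)
  then have \<eta>: "((\<lambda>t. \<bar>(d t - m) + (h t - q) * p\<bar>) \<longlongrightarrow> 0) (at_right 0)"
    by (auto dest: tendsto_rabs)
  have "((\<lambda>t. \<bar>h t\<bar>) \<longlongrightarrow> q) (at_right 0)" using tendsto_rabs[OF h] q by simp
  from order_tendstoD(2)[OF this r(1)] have hr: "\<forall>\<^sub>F t in at_right 0. \<bar>h t\<bar> < r" .
  have "(\<tau> \<longlongrightarrow> p) (at_right 0)"
  proof (rule tendstoI)
    fix \<epsilon> :: real assume \<epsilon>: "\<epsilon> > 0"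
    then have "\<epsilon> / 2 * (1 - r) > 0" using r by simp
    from order_tendstoD(2)[OF \<eta> this] bounded rec hr
    have "\<forall>\<^sub>F t in at_right 0. \<bar>(d t - m) + (h t - q) * p\<bar> < \<epsilon> / 2 * (1 - r) \<and> \<bar>\<tau> t\<bar> \<le> B \<and>
       \<tau> t = d t + h t * \<tau> (t / 2) \<and> \<bar>h t\<bar> < r"
      by eventually_elim simp
    then obtain \<delta> where \<delta>: "\<delta> > 0" "\<And>t. 0 < t \<Longrightarrow> t < \<delta> \<Longrightarrow> \<bar>(d t - m) + (h t - q) * p\<bar> < \<epsilon> / 2 * (1 - r) \<and> \<bar>\<tau> t\<bar> \<le> B \<and>
       \<tau> t = d t + h t * \<tau> (t / 2) \<and> \<bar>h t\<bar> < r"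
      by (auto simp: eventually_at_right_field)
    \<comment> \<open>The value \<epsilon> / 2 is fixed under e -> (1 - r) \<epsilon> / 2 + r e, so
      it survives all iterations while the initial bound decays like r^n.\<close>
    have le: "\<bar>\<tau> t - p\<bar> \<le> \<epsilon> / 2 + r ^ n * (B + \<bar>p\<bar>)" if "0 < t" "t < \<delta>" for t n
      using that
    proof (induction n arbitrary: t)
      case 0
      then have "\<bar>\<tau> t\<bar> \<le> B" using \<delta>(2)[of t] by auto
      then have "\<bar>\<tau> t - p\<bar> \<le> B + \<bar>p\<bar>" by linarith
      then show ?case using \<epsilon> by simp
    next
      case (Suc n)
      have t: "\<bar>(d t - m) + (h t - q) * p\<bar> < \<epsilon> / 2 * (1 - r)" "\<tau> t = d t + h t * \<tau> (t / 2)" "\<bar>h t\<bar> < r"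
        using \<delta>(2)[of t] Suc.prems by auto
      have "\<tau> t - p = ((d t - m) + (h t - q) * p) + h t * (\<tau> (t / 2) - p)"
        unfolding t(2) using p by (simp add: algebra_simps)
      then have "\<bar>\<tau> t - p\<bar> \<le> \<bar>(d t - m) + (h t - q) * p\<bar> + \<bar>h t\<bar> * \<bar>\<tau> (t / 2) - p\<bar>"
        using abs_triangle_ineq[of "(d t - m) + (h t - q) * p" "h t * (\<tau> (t / 2) - p)"] by (simp add: abs_mult)
      also have "\<dots> \<le> \<epsilon> / 2 * (1 - r) + r * (\<epsilon> / 2 + r ^ n * (B + \<bar>p\<bar>))"
        using t Suc.IH[of "t / 2"] Suc.prems by (intro add_mono mult_mono) auto
      also have "\<dots> = \<epsilon> / 2 + r ^ Suc n * (B + \<bar>p\<bar>)" by (simp add: field_simps)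
      finally show ?case .
    qed
    have lim: "(\<lambda>n. \<epsilon> / 2 + r ^ n * (B + \<bar>p\<bar>)) \<longlonglongrightarrow> \<epsilon> / 2 + 0 * (B + \<bar>p\<bar>)"
      using r q by (intro tendsto_intros LIMSEQ_power_zero) auto
    have "\<bar>\<tau> t - p\<bar> < \<epsilon>" if "0 < t" "t < \<delta>" for t
    proof -
      have "\<bar>\<tau> t - p\<bar> \<le> \<epsilon> / 2 + 0 * (B + \<bar>p\<bar>)" by (rule LIMSEQ_le_const[OF lim]) (use le that in auto)
      then show ?thesis using \<epsilon> by simp
    qed
    then show "\<forall>\<^sub>F t in at_right 0. dist (\<tau> t) p < \<epsilon>"
      using \<delta>(1) by (auto simp: eventually_at_right_field dist_real_def)
  qed
  then show ?thesis by (simp add: p_def)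
qed

section \<open>Test functions for dyadic shells\<close>

text \<open>The value at the jump is left free: d = 0 gives strict tails, and d = 1/2 gives the
  tails of the intermediate distribution function.\<close>

definition step :: "real \<Rightarrow> real \<Rightarrow> real" where
  "step d y = (if y > 1 then 1 else if y = 1 then d else 0)"

lemma measurable_step [measurable]: "step d \<in> borel_measurable borel"
  unfolding step_def by measurable

text \<open>The shell from a to 2 a divided by the weight, so that integration against
  \<open>weighted_law\<close> returns an unweighted difference of tails.\<close>

definition shell_fun :: "real \<Rightarrow> real \<Rightarrow> real \<Rightarrow> real" where
  "shell_fun a d y = (step d (y / a) - step d (y / (2 * a))) / (1 - cos y)"

text \<open>On \<open>{a..2*a}\<close>, which lies strictly between 0 and pi, the denominator is
  nonzero; elsewhere the numerator vanishes, including at the other zeros of 1 - cos.\<close>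

lemma shell_fun_numerator:
  assumes "1/2 < a" "a < 1"
  shows "(1 - cos y) * shell_fun a d y = step d (y / a) - step d (y / (2 * a))"
proof (cases "y \<in> {a..2*a}")
  case True
  then have "cos y < cos 0" using assms pi_gt3 by (intro cos_monotone_0_pi) auto
  then show ?thesis by (simp add: shell_fun_def)
next
  case False
  then show ?thesis using assms by (auto simp: shell_fun_def step_def field_simps)
qed

lemma abs_shell_fun_le:
  assumes "1/2 < a" "a < 1" "0 \<le> d" "d \<le> 1"
  shows "\<bar>shell_fun a d y\<bar> \<le> 1 / (1 - cos (1/2))"
proof -
  have c: "cos (1/2) < cos (0::real)" using pi_gt3 by (intro cos_monotone_0_pi) auto
  show ?thesis
  proof (cases "y \<in> {a..2*a}")
    case True
    then have "cos y \<le> cos (1/2)" using assms pi_gt3 by (intro cos_monotone_0_pi_le) auto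
    moreover have "\<bar>step d (y / a) - step d (y / (2 * a))\<bar> \<le> 1" using assms by (auto simp: step_def)
    ultimately show ?thesis using c unfolding shell_fun_def abs_divide
      by (intro frac_le) auto
  next
    case False
    then show ?thesis using assms c by (auto simp: shell_fun_def step_def field_simps)
  qed
qed

lemma isCont_shell_fun:
  assumes "1/2 < a" "a < 1" "y \<noteq> a" "y \<noteq> 2 * a"
  shows "isCont (shell_fun a d) y"
proof -
  have a: "a > 0" using assms by simp
  consider "y \<in> {..<a}" | "y \<in> {a<..<2*a}" | "y \<in> {2*a<..}" using assms by force
  then show ?thesis
  proof cases
    case 1
    have "continuous_on {..<a} (\<lambda>_. 0 :: real)" by simp
    then have "continuous_on {..<a} (shell_fun a d)"
      by (rule continuous_on_eq) (use a in \<open>auto simp: shell_fun_def step_def field_simps\<close>)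
    then show ?thesis using 1 by (simp add: continuous_on_eq_continuous_at)
  next
    case 2
    have "cos x \<noteq> 1" if "x \<in> {a<..<2*a}" for x
    proof -
      have "cos x < cos 0" using assms that pi_gt3 by (intro cos_monotone_0_pi) auto
      then show ?thesis by simp
    qed
    then have "continuous_on {a<..<2*a} (\<lambda>y. 1 / (1 - cos y))"
      by (intro continuous_intros) force
    then have "continuous_on {a<..<2*a} (shell_fun a d)"
      by (rule continuous_on_eq) (use a in \<open>auto simp: shell_fun_def step_def field_simps\<close>)
    then show ?thesis using 2 by (simp add: continuous_on_eq_continuous_at)
  next
    case 3
    have "continuous_on {2*a<..} (\<lambda>_. 0 :: real)" by simp
    then have "continuous_on {2*a<..} (shell_fun a d)"
      by (rule continuous_on_eq) (use a in \<open>auto simp: shell_fun_def step_def field_simps\<close>)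
    then show ?thesis using 3 by (simp add: continuous_on_eq_continuous_at)
  qed
qed

lemma measurable_shell_fun [measurable]: "shell_fun a d \<in> borel_measurable borel"
  unfolding shell_fun_def by measurable

context cf_reg_var
begin

section \<open>The limit of the right tail divided by g\<close>

text \<open>For t > 0 this is the right tail of X at 1 / t, an atom there being counted with weight
  d.\<close>

definition tail :: "real \<Rightarrow> real \<Rightarrow> real" where
  "tail d t = expectation (\<lambda>\<omega>. step d (t * X \<omega>))"

lemma integrable_step: "integrable M (\<lambda>\<omega>. step d (t * X \<omega>))"
  by (rule integrable_bounded[where B = "max 1 \<bar>d\<bar>"]) (auto simp: step_def)

text \<open>Pointwise, 1 - cos (2 u) = 2 (1 + cos u) (1 - cos u), and the first two factors
  contribute at most 4.\<close>

lemma g_double_le: "g (2 * t) \<le> 4 * g t"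
proof -
  have le: "1 - cos (2 * u) \<le> 4 * (1 - cos u)" for u :: real
  proof -
    have "1 - cos (2 * u) = 2 * (1 + cos u) * (1 - cos u)"
      unfolding cos_double_cos by (simp add: power2_eq_square algebra_simps)
    also have "\<dots> \<le> 4 * (1 - cos u)" by (intro mult_right_mono) auto
    finally show ?thesis .
  qed
  have int: "integrable M (\<lambda>\<omega>. 1 - cos (s * X \<omega>))" for s
    by (rule integrable_bounded[where B = 2 and f = "\<lambda>x. 1 - cos x"])
       (auto intro: abs_triangle_ineq4[THEN order_trans] add_mono[of _ 1 _ 1, simplified])
  have "g (2 * t) \<le> expectation (\<lambda>\<omega>. 4 * (1 - cos (t * X \<omega>)))"
    unfolding g_eq using le[of "t * X _"] by (intro integral_mono int integrable_mult_right) (simp add: mult.assoc)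
  also have "\<dots> = 4 * g t" unfolding g_eq by (rule integral_mult_right_zero)
  finally show ?thesis .
qed

text \<open>Weak convergence tested with \<open>shell_fun\<close> gives the limit of the shell
  probability at scale t / a; regular variation of g then removes the auxiliary a.\<close>

lemma tail_shell_limit:
  "\<exists>m. \<forall>d\<in>{0..1}. ((\<lambda>t. (tail d t - tail d (t / 2)) / g t) \<longlongrightarrow> m) (at_right 0)"
proof -
  interpret L: real_distribution limit_law by (rule limit_law(1))
  \<comment> \<open>Neither a nor 2 a may be an atom of the limit law. Only countably many values of
    a are excluded, so one remains between 1/2 and 1.\<close>
  let ?A = "{x. measure limit_law {x} \<noteq> 0}"
  have "countable (?A \<union> (\<lambda>x. x / 2) ` ?A)"
    using L.countable_support by (intro countable_Un countable_image)
  moreover have "uncountable {1/2<..<1::real}" by (simp add: uncountable_open_interval)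
  ultimately obtain a where a: "a \<in> {1/2<..<1}" "a \<notin> ?A \<union> (\<lambda>x. x / 2) ` ?A"
    by (metis countable_subset subsetI)
  then have a12: "1/2 < a" "a < 1" by auto
  have "2 * a \<notin> ?A"
  proof
    assume "2 * a \<in> ?A"
    then have "a \<in> (\<lambda>x. x / 2) ` ?A" by (intro image_eqI[of _ _ "2 * a"]) auto
    with a(2) show False by blast
  qed
  then have at: "L.prob {a} = 0" "L.prob {2 * a} = 0" using a(2) by auto
  then have null: "{a, 2 * a} \<in> null_sets limit_law"
    using null_sets.Un[of "{a}" limit_law "{2 * a}"]
    by (auto simp: null_sets_def L.emeasure_eq_measure insert_commute)
  \<comment> \<open>The value d matters only at the two null points a and 2 a, so d = 0 represents
    all choices.\<close>
  define m where "m = integral\<^sup>L limit_law (shell_fun a 0)"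
  have "((\<lambda>t. (tail d t - tail d (t / 2)) / g t) \<longlongrightarrow> m * a powr k) (at_right 0)" if d: "d \<in> {0..1}" for d
  proof -
    have "{x. \<not> isCont (shell_fun a d) x} \<subseteq> {a, 2 * a}"
      using isCont_shell_fun[OF a12] by auto
    then have "emeasure limit_law {x. \<not> isCont (shell_fun a d) x} = 0"
      using null by (metis emeasure_mono null_setsD1 null_setsD2 le_zero_eq)
    then have "((\<lambda>t. integral\<^sup>L (weighted_law t) (shell_fun a d)) \<longlongrightarrow> integral\<^sup>L limit_law (shell_fun a d)) (at_right 0)"
      using abs_shell_fun_le[OF a12] d by (intro weak_limit) auto
    also have "integral\<^sup>L limit_law (shell_fun a d) = m"
      unfolding m_def
    proof (rule integral_cong_AE)
      show "AE x in limit_law. shell_fun a d x = shell_fun a 0 x"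
        using AE_not_in[OF null] by eventually_elim (use a12 in \<open>auto simp: shell_fun_def step_def field_simps\<close>)
    qed auto
    also have "(\<lambda>t. integral\<^sup>L (weighted_law t) (shell_fun a d)) = (\<lambda>t. (tail d (t / a) - tail d (t / a / 2)) / g t)"
    proof
      fix t
      have "integral\<^sup>L (weighted_law t) (shell_fun a d) = (\<integral>\<omega>. (step d (t / a * X \<omega>) - step d (t / a / 2 * X \<omega>)) / g t \<partial>M)"
      proof (subst integral_weighted_law, simp, intro Bochner_Integration.integral_cong refl)
        fix \<omega>
        show "((1 - cos (t * X \<omega>)) / g t) *\<^sub>R shell_fun a d (t * X \<omega>) = (step d (t / a * X \<omega>) - step d (t / a / 2 * X \<omega>)) / g t"
          using shell_fun_numerator[OF a12, of "t * X \<omega>" d] by (simp add: mult_ac)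
      qed
      also have "\<dots> = (tail d (t / a) - tail d (t / a / 2)) / g t"
        unfolding tail_def
        by (subst integral_divide_zero, subst Bochner_Integration.integral_diff, (rule integrable_step)+, rule refl)
      finally show "integral\<^sup>L (weighted_law t) (shell_fun a d) = (tail d (t / a) - tail d (t / a / 2)) / g t" .
    qed
    finally have "((\<lambda>t. (tail d (t / a) - tail d (t / a / 2)) / g t) \<longlongrightarrow> m) (at_right 0)" .
    from filterlim_compose[OF this filterlim_scale_at_right_0[of a]] a12
    have "((\<lambda>t. (tail d t - tail d (t / 2)) / g (a * t)) \<longlongrightarrow> m) (at_right 0)" by simp
    then have "((\<lambda>t. (tail d t - tail d (t / 2)) / g (a * t) * (g (a * t) / g t)) \<longlongrightarrow> m * a powr k) (at_right 0)"
      using a12 by (intro tendsto_mult g_scale) auto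
    moreover have "\<forall>\<^sub>F t in at_right 0. g (a * t) > 0"
      using filterlim_scale_at_right_0[of a] eventually_g_pos a12 by (auto simp: filterlim_iff)
    then have "\<forall>\<^sub>F t in at_right 0. (tail d t - tail d (t / 2)) / g (a * t) * (g (a * t) / g t) = (tail d t - tail d (t / 2)) / g t"
      by eventually_elim auto
    ultimately show ?thesis by (rule Lim_transform_eventually)
  qed
  then show ?thesis by blast
qed

lemma tail_nonneg: "0 \<le> d \<Longrightarrow> 0 \<le> tail d t"
  unfolding tail_def by (intro integral_nonneg_AE) (auto simp: step_def)

text \<open>The support of \<open>step\<close> includes the point 1, which the strict tail event
  misses at scale t but contains at scale 2 t; returning from g (2 t) to g t costs the factor
  4.\<close>

lemma tail_over_g_bounded:
  "\<exists>B. \<forall>d\<in>{0..1}. \<forall>\<^sub>F t in at_right 0. \<bar>tail d t / g t\<bar> \<le> B"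
proof -
  obtain t0 \<rho> C where tc: "dyadic_tail_bound t0 \<rho> C" using dyadic_tail_bound_exists by blast
  then have t0: "t0 > 0" and C: "C > 0" and gpos: "\<And>t. 0 < t \<Longrightarrow> t \<le> t0 \<Longrightarrow> g t > 0"
    and tl: "\<And>t. 0 < t \<Longrightarrow> t \<le> t0 \<Longrightarrow> prob {\<omega> \<in> space M. 1 < \<bar>t * X \<omega>\<bar>} \<le> C * g t"
    unfolding dyadic_tail_bound_def by (auto dest!: spec[where x = "0::nat"])
  have "\<forall>\<^sub>F t in at_right 0. \<bar>tail d t / g t\<bar> \<le> 4 * C" if d: "d \<in> {0..1}" for d
    unfolding eventually_at_right_field
  proof (intro exI[of _ "t0 / 2"] conjI allI impI)
    fix t assume t: "0 < t" "t < t0 / 2"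
    let ?A = "{\<omega> \<in> space M. 1 < \<bar>2 * t * X \<omega>\<bar>}"
    have "tail d t \<le> expectation (indicat_real ?A)"
      unfolding tail_def
    proof (intro integral_mono integrable_step integrable_real_indicator)
      fix \<omega> assume "\<omega> \<in> space M"
      moreover have "\<bar>2 * t * X \<omega>\<bar> = 2 * \<bar>t * X \<omega>\<bar>" by (simp add: abs_mult)
      ultimately show "step d (t * X \<omega>) \<le> indicat_real ?A \<omega>"
        using d by (auto simp: step_def indicator_def)
    qed (auto simp: less_top[symmetric])
    also have "\<dots> = prob ?A" by simp
    also have "\<dots> \<le> C * g (2 * t)" using t by (intro tl) auto
    also have "\<dots> \<le> C * (4 * g t)" using g_double_le C by (intro mult_left_mono) auto
    finally show "\<bar>tail d t / g t\<bar> \<le> 4 * C" using gpos[of t] t tail_nonneg[of d t] d by (simp add: field_simps)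
  qed (use t0 in auto)
  then show ?thesis by blast
qed

text \<open>The quotient of tail and g obeys the halving recursion, with the shell limit as forcing
  term and contraction factor g (t/2) / g t tending to (1/2)^k < 1.\<close>

lemma tail_limit_exists:
  "\<exists>p\<ge>0. \<forall>d\<in>{0..1}. ((\<lambda>t. tail d t / g t) \<longlongrightarrow> p) (at_right 0)"
proof -
  obtain m where m: "\<And>d. d \<in> {0..1} \<Longrightarrow> ((\<lambda>t. (tail d t - tail d (t / 2)) / g t) \<longlongrightarrow> m) (at_right 0)"
    using tail_shell_limit by blast
  obtain B where B: "\<And>d. d \<in> {0..1} \<Longrightarrow> \<forall>\<^sub>F t in at_right 0. \<bar>tail d t / g t\<bar> \<le> B"
    using tail_over_g_bounded by blast
  define p where "p = m / (1 - (1/2) powr k)"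
  have lim: "((\<lambda>t. tail d t / g t) \<longlongrightarrow> p) (at_right 0)" if d: "d \<in> {0..1}" for d
    unfolding p_def
  proof (rule tendsto_halving_recursion[OF m[OF d] _ _ _ B[OF d]])
    show "((\<lambda>t. g (1/2 * t) / g t) \<longlongrightarrow> (1/2) powr k) (at_right 0)" by (rule g_scale) simp
    show "(1/2) powr k < (1::real)" using gr_one_powr[of 2 k] k_pos by (simp add: powr_divide)
    have "\<forall>\<^sub>F t in at_right 0. g (1/2 * t) > 0"
      using filterlim_scale_at_right_0[of "1/2"] eventually_g_pos by (auto simp: filterlim_iff)
    then show "\<forall>\<^sub>F t in at_right 0. tail d t / g t = (tail d t - tail d (t / 2)) / g t + g (1/2 * t) / g t * (tail d (t / 2) / g (t / 2))"
      by eventually_elim (auto simp: diff_divide_distrib)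
  qed simp
  moreover have "p \<ge> 0"
    by (rule tendsto_lowerbound[OF lim[of 0]])
       (auto intro!: always_eventually divide_nonneg_nonneg tail_nonneg g_nonneg)
  ultimately show ?thesis by blast
qed

definition right_coeff :: real where
  "right_coeff = (SOME p. 0 \<le> p \<and> (\<forall>d\<in>{0..1}. ((\<lambda>t. tail d t / g t) \<longlongrightarrow> p) (at_right 0)))"

lemma right_coeff: "0 \<le> right_coeff"
  "0 \<le> d \<Longrightarrow> d \<le> 1 \<Longrightarrow> ((\<lambda>t. tail d t / g t) \<longlongrightarrow> right_coeff) (at_right 0)"
  using someI_ex[OF tail_limit_exists[unfolded Bex_def]] by (auto simp: right_coeff_def)

end

section \<open>Convergence away from the origin\<close>

text \<open>The restriction to x at least a of the limit measure with density k x^(-k-1), normalised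
  to a probability by the factor a^k.\<close>

definition pareto :: "real \<Rightarrow> real \<Rightarrow> real measure" where
  "pareto k a = density lborel (\<lambda>x. ennreal (k * a powr k * x powr (- k - 1)) * indicator {a..} x)"

context
  fixes k a :: real
  assumes k_pos: "0 < k" and a_pos: "0 < a"
begin

lemma emeasure_pareto_atLeast:
  assumes "a \<le> x"
  shows "emeasure (pareto k a) {x..} = ennreal ((x / a) powr - k)"
proof -
  have "emeasure (pareto k a) {x..} = (\<integral>\<^sup>+y. ennreal (k * a powr k * y powr (- k - 1)) * indicator {x..} y \<partial>lborel)"
    unfolding pareto_def using assms by (subst emeasure_density) (auto simp: indicator_def intro!: nn_integral_cong)
  also have "\<dots> = ennreal (0 - (- (a powr k * x powr - k)))"
  proof (rule nn_integral_FTC_atLeast)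
    show "((\<lambda>y. - (a powr k * y powr - k)) \<longlongrightarrow> 0) at_top" using k_pos by real_asymp
    show "((\<lambda>y. - (a powr k * y powr - k)) has_real_derivative k * a powr k * y powr (- k - 1)) (at y)" if "x \<le> y" for y
      using that assms a_pos by (auto intro!: derivative_eq_intros)
  qed (use k_pos in auto)
  also have "0 - (- (a powr k * x powr - k)) = (x / a) powr - k"
    using assms a_pos by (simp add: powr_divide powr_minus field_simps)
  finally show ?thesis .
qed

lemma real_distribution_pareto: "real_distribution (pareto k a)"
proof -
  have "emeasure (pareto k a) UNIV = emeasure (pareto k a) {a..}"
    unfolding pareto_def by (subst (1 2) emeasure_density) (auto simp: indicator_def intro!: nn_integral_cong)
  also have "\<dots> = 1" using emeasure_pareto_atLeast[of a] a_pos by simp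
  finally have "prob_space (pareto k a)" by (intro prob_spaceI) (simp add: pareto_def)
  then show ?thesis
    by (simp add: real_distribution_def real_distribution_axioms_def pareto_def)
qed

lemma cdf_pareto: "cdf (pareto k a) x = (if x \<le> a then 0 else 1 - (x / a) powr - k)"
proof -
  interpret P: real_distribution "pareto k a" by (rule real_distribution_pareto)
  have sing: "P.prob {y} = 0" for y
  proof -
    have "AE z in lborel. ennreal (k * a powr k * z powr (- k - 1)) * indicator {a..} z * indicator {y} z = 0"
      using AE_lborel_singleton[of y] by eventually_elim auto
    then have "emeasure (pareto k a) {y} = 0"
      unfolding pareto_def by (subst emeasure_density) (auto simp: nn_integral_0_iff_AE)
    then show ?thesis by (simp add: measure_def)
  qed
  have ge: "P.prob {y..} = (y / a) powr - k" if "a \<le> y" for y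
    using emeasure_pareto_atLeast[OF that] by (simp add: measure_def)
  have "cdf (pareto k a) y = 1 - (y / a) powr - k" if "a \<le> y" for y
  proof -
    have "{..y} = {..<y} \<union> {y}" by auto
    then have "P.prob {..y} = P.prob {..<y} + P.prob {y}"
      by (simp only:) (rule P.finite_measure_Union, auto)
    also have "P.prob {..<y} = 1 - P.prob {y..}"
      using P.prob_compl[of "{y..}"] by (simp add: Compl_eq_Diff_UNIV[symmetric])
    finally show ?thesis using ge[OF that] sing by (simp add: cdf_def)
  qed
  note c = this
  show ?thesis
  proof (cases "x \<le> a")
    case True
    then have "cdf (pareto k a) x \<le> cdf (pareto k a) a" by (rule P.cdf_nondecreasing)
    also have "\<dots> = 0" using c[of a] a_pos by simp
    finally show ?thesis using True P.cdf_nonneg[of x] by simp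
  qed (use c in auto)
qed

lemma integral_pareto:
  fixes f :: "real \<Rightarrow> real"
  assumes [measurable]: "f \<in> borel_measurable borel"
  shows "integral\<^sup>L (pareto k a) f = k * a powr k * (LBINT x:{a..}. f x * x powr (- k - 1))"
proof -
  have "pareto k a = density lborel (\<lambda>x. ennreal (k * a powr k * x powr (- k - 1) * indicator {a..} x))"
    unfolding pareto_def using k_pos by (intro arg_cong[where f = "density lborel"] ext) (simp add: indicator_def)
  then have "integral\<^sup>L (pareto k a) f = (LBINT x. (k * a powr k * x powr (- k - 1) * indicator {a..} x) *\<^sub>R f x)"
    using k_pos by (simp add: integral_density)
  also have "\<dots> = (LBINT x. (k * a powr k) * (indicator {a..} x *\<^sub>R (f x * x powr (- k - 1))))"
    by (intro Bochner_Integration.integral_cong) auto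
  also have "\<dots> = k * a powr k * (LBINT x:{a..}. f x * x powr (- k - 1))"
    unfolding set_lebesgue_integral_def by (rule integral_mult_right_zero)
  finally show ?thesis .
qed

end

text \<open>Dominated convergence along sequences decreasing to 0, with |h| on the half-line as
  majorant.\<close>

lemma set_integral_atLeast_tendsto_greaterThan:
  fixes h :: "real \<Rightarrow> real"
  assumes "set_integrable lborel {0<..} h"
  shows "((\<lambda>a. LBINT x:{a..}. h x) \<longlongrightarrow> (LBINT x:{0<..}. h x)) (at_right 0)"
proof (rule tendsto_at_right_sequentially[of 0 1])
  fix S :: "nat \<Rightarrow> real" assume S: "\<And>n. 0 < S n" "S \<longlonglongrightarrow> 0"
  show "(\<lambda>n. LBINT x:{S n..}. h x) \<longlonglongrightarrow> (LBINT x:{0<..}. h x)"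
    unfolding set_lebesgue_integral_def
  proof (rule integral_dominated_convergence)
    have m: "(\<lambda>x. indicator {0<..} x *\<^sub>R h x) \<in> borel_measurable lborel"
      using assms unfolding set_integrable_def by (rule borel_measurable_integrable)
    then show "(\<lambda>x. indicator {0<..} x *\<^sub>R h x) \<in> borel_measurable lborel" .
    show "integrable lborel (\<lambda>x. norm (indicator {0<..} x *\<^sub>R h x))"
      using assms unfolding set_integrable_def by (rule integrable_norm)
    fix n
    have "(\<lambda>x. indicator {S n..} x *\<^sub>R (indicator {0<..} x *\<^sub>R h x)) \<in> borel_measurable lborel"
      by (rule borel_measurable_scaleR[OF _ m]) auto
    also have "(\<lambda>x. indicator {S n..} x *\<^sub>R (indicator {0<..} x *\<^sub>R h x)) = (\<lambda>x. indicator {S n..} x *\<^sub>R h x)"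
      using S(1)[of n] by (auto simp: indicator_def fun_eq_iff)
    finally show "(\<lambda>x. indicator {S n..} x *\<^sub>R h x) \<in> borel_measurable lborel" .
    show "AE x in lborel. norm (indicator {S n..} x *\<^sub>R h x) \<le> norm (indicator {0<..} x *\<^sub>R h x)"
      using S(1)[of n] by (auto simp: indicator_def)
  next
    show "AE x in lborel. (\<lambda>n. indicator {S n..} x *\<^sub>R h x) \<longlonglongrightarrow> indicator {0<..} x *\<^sub>R h x"
    proof (intro always_eventually allI)
      fix x
      show "(\<lambda>n. indicator {S n..} x *\<^sub>R h x) \<longlonglongrightarrow> indicator {0<..} x *\<^sub>R h x"
      proof (cases "x > 0")
        case True
        from order_tendstoD(2)[OF S(2) this]
        have "\<forall>\<^sub>F n in sequentially. indicator {S n..} x *\<^sub>R h x = indicator {0<..} x *\<^sub>R h x"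
          by eventually_elim (use True in auto)
        then show ?thesis by (rule tendsto_eventually)
      next
        case False
        have "\<not> S n \<le> x" for n using False S(1)[of n] by linarith
        then have "(\<lambda>n. indicator {S n..} x *\<^sub>R h x) = (\<lambda>n. indicator {0<..} x *\<^sub>R h x)"
          using False by (auto simp: indicator_def fun_eq_iff)
        then show ?thesis by simp
      qed
    qed
  qed
qed simp

context cf_reg_var
begin

section \<open>From tails to expectations\<close>

text \<open>The event is the strict tail at scale t / x, and regular variation of g supplies the
  power of x.\<close>

lemma prob_greater_limit:
  assumes "x > 0"
  shows "((\<lambda>t. prob {\<omega> \<in> space M. x < t * X \<omega>} / g t) \<longlongrightarrow> right_coeff * x powr - k) (at_right 0)"
proof -
  have eq: "tail 0 (1 / x * t) = prob {\<omega> \<in> space M. x < t * X \<omega>}" for t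
  proof -
    have "tail 0 (1 / x * t) = expectation (indicat_real {\<omega> \<in> space M. x < t * X \<omega>})"
      unfolding tail_def by (intro Bochner_Integration.integral_cong) (use assms in \<open>auto simp: step_def indicator_def field_simps\<close>)
    then show ?thesis by simp
  qed
  have lim: "((\<lambda>t. tail 0 t / g t) \<longlongrightarrow> right_coeff) (at_right 0)" by (rule right_coeff) auto
  have "((\<lambda>t. tail 0 (1 / x * t) / g (1 / x * t) * (g (1 / x * t) / g t)) \<longlongrightarrow> right_coeff * (1 / x) powr k) (at_right 0)"
    using filterlim_compose[OF lim filterlim_scale_at_right_0[of "1 / x"]] assms
    by (intro tendsto_mult g_scale) auto
  moreover have "\<forall>\<^sub>F t in at_right 0. g (1 / x * t) > 0"
    using filterlim_scale_at_right_0[of "1 / x"] eventually_g_pos assms by (auto simp: filterlim_iff)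
  then have "\<forall>\<^sub>F t in at_right 0. tail 0 (1 / x * t) / g (1 / x * t) * (g (1 / x * t) / g t) = tail 0 (1 / x * t) / g t"
    by eventually_elim auto
  ultimately have "((\<lambda>t. tail 0 (1 / x * t) / g t) \<longlongrightarrow> right_coeff * (1 / x) powr k) (at_right 0)"
    by (rule Lim_transform_eventually)
  moreover have "(1 / x) powr k = x powr - k" using assms by (simp add: powr_divide powr_minus field_simps)
  ultimately show ?thesis by (simp only: eq)
qed

text \<open>Conditioned on exceeding a, t X has a distribution function built from a ratio of two
  tails; both have limits over g, and their ratio is the Pareto tail. Positivity of
  \<open>right_coeff\<close> keeps the denominator away from 0.\<close>

lemma conditional_weak_limit:
  fixes f :: "real \<Rightarrow> real"
  assumes a: "a > 0" and p: "right_coeff > 0" and f: "\<And>x. isCont f x" "\<And>x. norm (f x) \<le> B"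
  shows "((\<lambda>t. expectation (\<lambda>\<omega>. f (t * X \<omega>) * indicator {a<..} (t * X \<omega>)) / prob {\<omega> \<in> space M. a < t * X \<omega>})
     \<longlongrightarrow> integral\<^sup>L (pareto k a) f) (at_right 0)"
proof -
  let ?A = "\<lambda>t. {\<omega> \<in> space M. a < t * X \<omega>}"
  have [measurable]: "f \<in> borel_measurable borel"
    using f(1) by (intro borel_measurable_continuous_onI continuous_at_imp_continuous_on) auto
  have "\<forall>\<^sub>F t in at_right 0. prob (?A t) / g t > 0"
    using order_tendstoD(1)[OF prob_greater_limit[OF a], of 0] a p by simp
  then have "\<forall>\<^sub>F t in at_right 0. prob (?A t) > 0"
    by eventually_elim (auto simp: zero_less_divide_iff)
  then obtain b where b: "b > 0" "\<And>t. 0 < t \<Longrightarrow> t < b \<Longrightarrow> prob (?A t) > 0"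
    by (auto simp: eventually_at_right_field)
  show ?thesis
  proof (rule tendsto_at_right_sequentially[OF b(1)])
    fix S :: "nat \<Rightarrow> real" assume S: "\<And>n. 0 < S n" "\<And>n. S n < b" "S \<longlonglongrightarrow> 0"
    have Slim: "filterlim S (at_right 0) sequentially"
      using S by (intro tendsto_imp_filterlim_at_right) auto
    have pos: "prob (?A (S n)) > 0" for n using S b by auto
    \<comment> \<open>The conditional law of \<open>S n * X\<close> given that it exceeds a.\<close>
    define L where "L n = distr (density M (\<lambda>\<omega>. ennreal (indicator (?A (S n)) \<omega> / prob (?A (S n))))) borel (\<lambda>\<omega>. S n * X \<omega>)" for n
    have int_L: "integral\<^sup>L (L n) h = expectation (\<lambda>\<omega>. h (S n * X \<omega>) * indicator {a<..} (S n * X \<omega>)) / prob (?A (S n))"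
      if [measurable]: "h \<in> borel_measurable borel" for h :: "real \<Rightarrow> real" and n
    proof -
      have "integral\<^sup>L (L n) h = expectation (\<lambda>\<omega>. (indicator (?A (S n)) \<omega> / prob (?A (S n))) *\<^sub>R h (S n * X \<omega>))"
        unfolding L_def by (subst integral_distr, simp, simp, subst integral_density) auto
      also have "\<dots> = expectation (\<lambda>\<omega>. h (S n * X \<omega>) * indicator {a<..} (S n * X \<omega>) / prob (?A (S n)))"
        by (intro Bochner_Integration.integral_cong) (auto simp: indicator_def)
      finally show ?thesis by (simp only: integral_divide_zero)
    qed
    have rd: "real_distribution (L n)" for n
    proof -
      have "(\<integral>\<^sup>+\<omega>. ennreal (indicator (?A (S n)) \<omega> / prob (?A (S n))) \<partial>M) = ennreal (expectation (\<lambda>\<omega>. indicator (?A (S n)) \<omega> / prob (?A (S n))))"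
        by (intro nn_integral_eq_integral integrable_divide integrable_real_indicator) (auto simp: less_top[symmetric])
      also have "expectation (\<lambda>\<omega>. indicator (?A (S n)) \<omega> / prob (?A (S n))) = 1"
        using pos[of n] by simp
      finally have "prob_space (density M (\<lambda>\<omega>. ennreal (indicator (?A (S n)) \<omega> / prob (?A (S n)))))"
        by (intro prob_spaceI) (auto simp: emeasure_density cong: nn_integral_cong)
      then show ?thesis unfolding L_def
        by (intro prob_space.real_distribution_distr) auto
    qed
    have cdf_L: "cdf (L n) x = (if x \<le> a then 0 else 1 - prob {\<omega> \<in> space M. x < S n * X \<omega>} / prob (?A (S n)))" for n x
    proof -
      interpret L: real_distribution "L n" by (rule rd)
      have "cdf (L n) x = integral\<^sup>L (L n) (indicat_real {..x})" by (simp add: cdf_def)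
      also have "\<dots> = expectation (\<lambda>\<omega>. indicator {..x} (S n * X \<omega>) * indicator {a<..} (S n * X \<omega>)) / prob (?A (S n))"
        by (rule int_L) auto
      also have "\<dots> = (if x \<le> a then 0 else 1 - prob {\<omega> \<in> space M. x < S n * X \<omega>} / prob (?A (S n)))"
      proof (cases "x \<le> a")
        case True
        then have z: "indicat_real {..x} y * indicator {a<..} y = 0" for y by (auto simp: indicator_def)
        show ?thesis unfolding z using True by simp
      next
        case False
        then have "expectation (\<lambda>\<omega>. indicator {..x} (S n * X \<omega>) * indicator {a<..} (S n * X \<omega>)) =
           expectation (\<lambda>\<omega>. indicat_real (?A (S n)) \<omega> - indicat_real {\<omega> \<in> space M. x < S n * X \<omega>} \<omega>)"
          by (intro Bochner_Integration.integral_cong) (auto simp: indicator_def)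
        also have "\<dots> = prob (?A (S n)) - prob {\<omega> \<in> space M. x < S n * X \<omega>}"
          by (subst Bochner_Integration.integral_diff) (auto intro!: integrable_real_indicator simp: less_top[symmetric])
        finally show ?thesis using False pos[of n] by (simp add: diff_divide_distrib)
      qed
      finally show ?thesis .
    qed
    have "weak_conv_m L (pareto k a)"
      unfolding weak_conv_m_def weak_conv_def
    proof (intro allI impI)
      fix x
      show "(\<lambda>n. cdf (L n) x) \<longlonglongrightarrow> cdf (pareto k a) x"
      proof (cases "x \<le> a")
        case False
        then have "((\<lambda>t. 1 - (prob {\<omega> \<in> space M. x < t * X \<omega>} / g t) / (prob (?A t) / g t)) \<longlongrightarrow>
            1 - (right_coeff * x powr - k) / (right_coeff * a powr - k)) (at_right 0)"
          using a p by (intro tendsto_intros prob_greater_limit) auto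
        also have "(right_coeff * x powr - k) / (right_coeff * a powr - k) = (x / a) powr - k"
          using p a False by (simp add: powr_divide)
        finally have "(\<lambda>n. 1 - (prob {\<omega> \<in> space M. x < S n * X \<omega>} / g (S n)) / (prob (?A (S n)) / g (S n))) \<longlonglongrightarrow> 1 - (x / a) powr - k"
          using Slim by (rule filterlim_compose)
        moreover have "\<forall>\<^sub>F n in sequentially. g (S n) > 0"
          using Slim eventually_g_pos by (auto simp: filterlim_iff)
        then have "\<forall>\<^sub>F n in sequentially. 1 - (prob {\<omega> \<in> space M. x < S n * X \<omega>} / g (S n)) / (prob (?A (S n)) / g (S n)) = cdf (L n) x"
          by eventually_elim (use False in \<open>simp add: cdf_L\<close>)
        ultimately show ?thesis
          using False by (simp add: cdf_pareto[OF k_pos a] Lim_transform_eventually)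
      qed (simp add: cdf_L cdf_pareto[OF k_pos a])
    qed
    then have "(\<lambda>n. integral\<^sup>L (L n) f) \<longlonglongrightarrow> integral\<^sup>L (pareto k a) f"
      using rd real_distribution_pareto[OF k_pos a] f by (intro weak_conv_imp_integral_bdd_continuous_conv) auto
    then show "(\<lambda>n. expectation (\<lambda>\<omega>. f (S n * X \<omega>) * indicator {a<..} (S n * X \<omega>)) / prob (?A (S n))) \<longlonglongrightarrow> integral\<^sup>L (pareto k a) f"
      by (simp add: int_L)
  qed
qed

text \<open>The conditional limit is multiplied by the limit of the conditioning probability over g;
  the powers of a from normalisation and tail cancel.\<close>

lemma truncated_limit:
  fixes f :: "real \<Rightarrow> real"
  assumes a: "a > 0" and f: "\<And>x. isCont f x" "\<And>x. norm (f x) \<le> B"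
  shows "((\<lambda>t. expectation (\<lambda>\<omega>. f (t * X \<omega>) * indicator {a<..} (t * X \<omega>)) / g t)
     \<longlongrightarrow> right_coeff * k * (LBINT x:{a..}. f x * x powr (- k - 1))) (at_right 0)"
proof -
  let ?A = "\<lambda>t. {\<omega> \<in> space M. a < t * X \<omega>}"
  let ?E = "\<lambda>t. expectation (\<lambda>\<omega>. f (t * X \<omega>) * indicator {a<..} (t * X \<omega>))"
  have [measurable]: "f \<in> borel_measurable borel"
    using f(1) by (intro borel_measurable_continuous_onI continuous_at_imp_continuous_on) auto
  have B: "0 \<le> B" using f(2)[of 0] by (rule order_trans[OF norm_ge_zero])
  have "\<bar>?E t\<bar> \<le> expectation (\<lambda>\<omega>. B * indicat_real (?A t) \<omega>)" for t
  proof (rule order_trans[OF integral_abs_bound], rule integral_mono)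
    show "integrable M (\<lambda>\<omega>. \<bar>f (t * X \<omega>) * indicator {a<..} (t * X \<omega>)\<bar>)"
      using f(2) B by (intro integrable_abs integrable_bounded[where B = B and f = "\<lambda>x. f x * indicator {a<..} x"]) (auto simp: indicator_def)
    show "integrable M (\<lambda>\<omega>. B * indicat_real (?A t) \<omega>)"
      by (intro integrable_mult_right integrable_real_indicator) (auto simp: less_top[symmetric])
    show "\<bar>f (t * X \<omega>) * indicator {a<..} (t * X \<omega>)\<bar> \<le> B * indicat_real (?A t) \<omega>" if "\<omega> \<in> space M" for \<omega>
      using f(2)[of "t * X \<omega>"] that by (auto simp: indicator_def)
  qed
  then have bound: "\<bar>?E t\<bar> \<le> B * prob (?A t)" for t by simp
  note lim = prob_greater_limit[OF a]
  show ?thesis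
  proof (cases "right_coeff = 0")
    case True
    have "((\<lambda>t. ?E t / g t) \<longlongrightarrow> 0) (at_right 0)"
    proof (rule Lim_null_comparison)
      show "\<forall>\<^sub>F t in at_right 0. norm (?E t / g t) \<le> B * (prob (?A t) / g t)"
        using bound g_nonneg by (auto intro!: always_eventually divide_right_mono)
      show "((\<lambda>t. B * (prob (?A t) / g t)) \<longlongrightarrow> 0) (at_right 0)"
        using tendsto_mult_right_zero[of "\<lambda>t. prob (?A t) / g t" "at_right 0" B] lim True by simp
    qed
    then show ?thesis using True by simp
  next
    case False
    then have p: "right_coeff > 0" using right_coeff(1) by simp
    have "((\<lambda>t. ?E t / prob (?A t) * (prob (?A t) / g t)) \<longlongrightarrow> integral\<^sup>L (pareto k a) f * (right_coeff * a powr - k)) (at_right 0)"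
      by (intro tendsto_mult conditional_weak_limit[OF a p f] lim)
    \<comment> \<open>If the probability is 0, then \<open>bound\<close> makes the expectation 0 as
      well, so cancelling is valid.\<close>
    moreover have "?E t / prob (?A t) * (prob (?A t) / g t) = ?E t / g t" for t
      using bound[of t] by (cases "prob (?A t) = 0") auto
    moreover have "integral\<^sup>L (pareto k a) f * (right_coeff * a powr - k) = right_coeff * k * (LBINT x:{a..}. f x * x powr (- k - 1))"
      using a by (simp add: integral_pareto[OF k_pos a] powr_minus field_simps)
    ultimately show ?thesis by (simp only:)
  qed
qed

text \<open>The bound \<open>\<bar>x\<bar> * (1 - cos x)\<close> makes the contribution of small values of \<open>t * X\<close>
  uniformly small in \<open>t\<close>, because \<open>1 - cos\<close> has normalised expectation 1.\<close>

lemma right_half_limit: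
  fixes f :: "real \<Rightarrow> real"
  assumes f: "\<And>x. isCont f x" "\<And>x. norm (f x) \<le> B" "\<And>x. \<bar>f x\<bar> \<le> \<bar>x\<bar> * (1 - cos x)"
    and int: "set_integrable lborel {0<..} (\<lambda>x. f x * x powr (- k - 1))"
  shows "((\<lambda>t. expectation (\<lambda>\<omega>. f (t * X \<omega>) * indicator {0<..} (t * X \<omega>)) / g t)
     \<longlongrightarrow> right_coeff * k * (LBINT x:{0<..}. f x * x powr (- k - 1))) (at_right 0)"
\<comment> \<open>The limits in a and t are interchanged, the one in a being uniform over all t with
  \<open>g t\<close> positive.\<close>
proof (rule swap_uniform_limit')
  let ?E = "\<lambda>a t. expectation (\<lambda>\<omega>. f (t * X \<omega>) * indicator {a<..} (t * X \<omega>)) / g t"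
  show "\<forall>\<^sub>F a in at_right 0. (?E a \<longlongrightarrow> right_coeff * k * (LBINT x:{a..}. f x * x powr (- k - 1))) (at_right 0)"
    using eventually_at_right_less by eventually_elim (rule truncated_limit[OF _ f(1,2)])
  show "((\<lambda>a. right_coeff * k * (LBINT x:{a..}. f x * x powr (- k - 1))) \<longlongrightarrow> right_coeff * k * (LBINT x:{0<..}. f x * x powr (- k - 1))) (at_right 0)"
    by (intro tendsto_mult_left set_integral_atLeast_tendsto_greaterThan int)
  show "\<forall>\<^sub>F t in at_right 0. t \<in> {t. g t > 0}" using eventually_g_pos by simp
  have [measurable]: "f \<in> borel_measurable borel"
    using f(1) by (intro borel_measurable_continuous_onI continuous_at_imp_continuous_on) auto
  have B: "0 \<le> B" using f(2)[of 0] by (rule order_trans[OF norm_ge_zero])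
  have int_f: "integrable M (\<lambda>\<omega>. f (t * X \<omega>) * indicator {a<..} (t * X \<omega>))" for a t
    using f(2) B by (intro integrable_bounded[where B = B and f = "\<lambda>x. f x * indicator {a<..} x"]) (auto simp: indicator_def)
  \<comment> \<open>The two truncations differ only where 0 < t X and t X is at most a; there |f| is
    at most a times the weight, whose expectation is \<open>g t\<close>.\<close>
  have close: "\<bar>?E a t - ?E 0 t\<bar> \<le> a" if t: "g t > 0" and a: "a > 0" for a t
  proof -
    have "\<bar>expectation (\<lambda>\<omega>. f (t * X \<omega>) * indicator {a<..} (t * X \<omega>) - f (t * X \<omega>) * indicator {0<..} (t * X \<omega>))\<bar>
       \<le> expectation (\<lambda>\<omega>. a * (1 - cos (t * X \<omega>)))"
    proof (rule order_trans[OF integral_abs_bound], rule integral_mono)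
      show "integrable M (\<lambda>\<omega>. a * (1 - cos (t * X \<omega>)))"
        by (intro integrable_mult_right integrable_bounded[where B = 2 and f = "\<lambda>x. 1 - cos x"])
           (auto intro: abs_triangle_ineq4[THEN order_trans] add_mono[of _ 1 _ 1, simplified])
      fix \<omega>
      let ?y = "t * X \<omega>"
      show "\<bar>f ?y * indicator {a<..} ?y - f ?y * indicator {0<..} ?y\<bar> \<le> a * (1 - cos ?y)"
      proof (cases "0 < ?y \<and> ?y \<le> a")
        case True
        then have "\<bar>f ?y\<bar> \<le> a * (1 - cos ?y)"
          using f(3)[of ?y] by (auto intro: order_trans[OF _ mult_right_mono])
        then show ?thesis using True by (auto simp: indicator_def)
      next
        case False
        then have z: "f ?y * indicator {a<..} ?y - f ?y * indicator {0<..} ?y = 0" using a by (auto simp: indicator_def)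
        show ?thesis unfolding z using a by simp
      qed
    qed (intro integrable_abs Bochner_Integration.integrable_diff int_f)
    also have "\<dots> = a * g t" unfolding g_eq by (rule integral_mult_right_zero)
    finally show ?thesis
      unfolding Bochner_Integration.integral_diff[OF int_f int_f] diff_divide_distrib[symmetric] abs_divide
      using t by (simp add: field_simps)
  qed
  show "uniform_limit {t. g t > 0} ?E (?E 0) (at_right 0)"
  proof (rule uniform_limitI)
    fix e :: real assume e: "e > 0"
    show "\<forall>\<^sub>F a in at_right 0. \<forall>t\<in>{t. g t > 0}. dist (?E a t) (?E 0 t) < e"
      unfolding eventually_at_right_field dist_real_def
      using close e by (intro exI[of _ e]) (auto intro: le_less_trans)
  qed
qed simp

section \<open>Two equations for the tail coefficients\<close>

lemma square_one_minus_cos_limit: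
  "((\<lambda>t. expectation (\<lambda>\<omega>. (1 - cos (t * X \<omega>))\<^sup>2) / g t) \<longlongrightarrow> 2 - 2 powr (k - 1)) (at_right 0)"
proof -
  have int: "integrable M (\<lambda>\<omega>. 1 - cos (s * X \<omega>))" for s
    by (rule integrable_bounded[where B = 2 and f = "\<lambda>x. 1 - cos x"])
       (auto intro: abs_triangle_ineq4[THEN order_trans] add_mono[of _ 1 _ 1, simplified])
  have "(1 - cos u)\<^sup>2 = 2 * (1 - cos (1 * u)) - (1 - cos (2 * u)) / 2" for u :: real
    unfolding cos_double_cos by (simp add: power2_eq_square field_simps)
  then have "expectation (\<lambda>\<omega>. (1 - cos (t * X \<omega>))\<^sup>2) =
      expectation (\<lambda>\<omega>. 2 * (1 - cos (1 * t * X \<omega>)) - (1 - cos (2 * t * X \<omega>)) / 2)" for t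
    by (simp add: mult.assoc)
  also have "\<dots> t = 2 * g (1 * t) - g (2 * t) / 2" for t
    unfolding g_eq
    by (subst Bochner_Integration.integral_diff, intro integrable_mult_right int, intro integrable_divide int,
        simp only: integral_mult_right_zero integral_divide_zero)
  finally have "expectation (\<lambda>\<omega>. (1 - cos (t * X \<omega>))\<^sup>2) / g t = 2 * (g (1 * t) / g t) - (g (2 * t) / g t) / 2" for t
    by (simp add: diff_divide_distrib)
  moreover have "((\<lambda>t. 2 * (g (1 * t) / g t) - (g (2 * t) / g t) / 2) \<longlongrightarrow> 2 * 1 powr k - 2 powr k / 2) (at_right 0)"
    by (intro tendsto_intros g_scale) auto
  ultimately show ?thesis by (simp add: powr_diff)
qed

text \<open>Since sin u (1 - cos u) = sin u - sin (2 u) / 2, the expectation is a combination of V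
  at t and 2 t.\<close>

lemma sin_one_minus_cos_limit:
  "((\<lambda>t. expectation (\<lambda>\<omega>. sin (t * X \<omega>) * (1 - cos (t * X \<omega>))) / g t) \<longlongrightarrow> c * (1 - 2 powr (k - 1))) (at_right 0)"
proof -
  have int: "integrable M (\<lambda>\<omega>. sin (s * X \<omega>))" for s
    by (rule integrable_bounded[where B = 1]) auto
  have "sin u * (1 - cos u) = sin (1 * u) - sin (2 * u) / 2" for u :: real
    unfolding sin_double by (simp add: algebra_simps)
  then have "expectation (\<lambda>\<omega>. sin (t * X \<omega>) * (1 - cos (t * X \<omega>))) =
      expectation (\<lambda>\<omega>. sin (1 * t * X \<omega>) - sin (2 * t * X \<omega>) / 2)" for t
    by (simp add: mult.assoc)
  also have "\<dots> t = cf_V M X (1 * t) - cf_V M X (2 * t) / 2" for t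
    unfolding cf_V_def
    by (subst Bochner_Integration.integral_diff) (intro integrable_divide int | simp)+
  finally have "expectation (\<lambda>\<omega>. sin (t * X \<omega>) * (1 - cos (t * X \<omega>))) / g t = cf_V M X (1 * t) / g t - (cf_V M X (2 * t) / g t) / 2" for t
    by (simp add: diff_divide_distrib)
  moreover have "((\<lambda>t. cf_V M X (1 * t) / g t - (cf_V M X (2 * t) / g t) / 2) \<longlongrightarrow> c * 1 powr k - c * 2 powr k / 2) (at_right 0)"
    by (intro tendsto_intros V_scale) auto
  moreover have "c * 1 powr k - c * 2 powr k / 2 = c * (1 - 2 powr (k - 1))"
    by (simp add: powr_diff algebra_simps)
  ultimately show ?thesis by (simp only:)
qed

text \<open>U is unchanged and V changes sign under reflection, which makes every result on the
  right tail available for the left one.\<close>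

lemma cf_reg_var_minus: "cf_reg_var M (\<lambda>\<omega>. - X \<omega>) k (- c)"
proof -
  have U: "cf_U M (\<lambda>\<omega>. - X \<omega>) = cf_U M X" and V: "cf_V M (\<lambda>\<omega>. - X \<omega>) t = - cf_V M X t" for t
    by (simp_all add: cf_U_def cf_V_def fun_eq_iff)
  show ?thesis
    by unfold_locales (use k_pos k_less_2 reg_var V_over_g in \<open>auto simp: U V intro: tendsto_minus\<close>)
qed

text \<open>Each test function has its limit computed twice, from the characteristic function and
  from the tails. The even one determines p + q, the odd one p - q.\<close>

lemma coefficients_exist:
  "\<exists>p q. 0 \<le> p \<and> 0 \<le> q \<and>
     ((\<lambda>t. expectation (\<lambda>\<omega>. step (1/2) (t * X \<omega>)) / g t) \<longlongrightarrow> p) (at_right 0) \<and>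
     ((\<lambda>t. expectation (\<lambda>\<omega>. step (1/2) (t * - X \<omega>)) / g t) \<longlongrightarrow> q) (at_right 0) \<and>
     2 - 2 powr (k - 1) = (p + q) * k * ((2 - 2 powr (k - 1)) * cos_moment k) \<and>
     c * (1 - 2 powr (k - 1)) = (p - q) * k * sin_moment k"
proof -
  interpret L: cf_reg_var M "\<lambda>\<omega>. - X \<omega>" k "- c" by (rule cf_reg_var_minus)
  have Lg: "L.g t = g t" for t by (simp add: L.g_eq g_eq)
  let ?p = right_coeff and ?q = L.right_coeff
  \<comment> \<open>The sign s is 1 for even and -1 for odd functions, so both test functions are
    treated together.\<close>
  have two_sided: "((\<lambda>t. expectation (\<lambda>\<omega>. f (t * X \<omega>)) / g t) \<longlongrightarrow>
      (?p + s * ?q) * k * (LBINT x:{0<..}. f x * x powr (- k - 1))) (at_right 0)"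
    if f: "\<And>x. isCont f x" "\<And>x. norm (f x) \<le> B" "\<And>x. \<bar>f x\<bar> \<le> \<bar>x\<bar> * (1 - cos x)"
      and int: "set_integrable lborel {0<..} (\<lambda>x. f x * x powr (- k - 1))"
      and parity: "\<And>x. f (- x) = s * f x" "s * s = 1"
    for f B s
  proof -
    let ?h = "\<lambda>x. f x * indicator {0<..} x"
    have [measurable]: "f \<in> borel_measurable borel"
      using f(1) by (intro borel_measurable_continuous_onI continuous_at_imp_continuous_on) auto
    have B: "0 \<le> B" using f(2)[of 0] by (rule order_trans[OF norm_ge_zero])
    have int_h: "integrable M (\<lambda>\<omega>. ?h (t * X \<omega>))" "integrable M (\<lambda>\<omega>. s * ?h (t * - X \<omega>))" for t
      using f(2) B
      by (intro integrable_mult_right integrable_bounded[where B = B and f = ?h] L.integrable_bounded[where B = B and f = ?h];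
          auto simp: indicator_def)+
    \<comment> \<open>Parity folds the negative half-line onto the positive one; at y = 0 the bound
      on f forces the value 0.\<close>
    have "f y = ?h y + s * ?h (- y)" for y
    proof (cases y "0::real" rule: linorder_cases)
      case less
      have "s * f (- y) = (s * s) * f y" unfolding parity(1) by (rule mult.assoc[symmetric])
      then show ?thesis using less parity(2) by simp
    next
      case equal
      have "f 0 = 0" using f(3)[of 0] by simp
      then show ?thesis using equal by simp
    qed simp
    then have "f (t * X \<omega>) = ?h (t * X \<omega>) + s * ?h (t * - X \<omega>)" for t \<omega> by (metis mult_minus_right)
    then have "expectation (\<lambda>\<omega>. f (t * X \<omega>)) = expectation (\<lambda>\<omega>. ?h (t * X \<omega>) + s * ?h (t * - X \<omega>))" for t
      by (simp only:)
    also have "\<dots> t = expectation (\<lambda>\<omega>. ?h (t * X \<omega>)) + s * expectation (\<lambda>\<omega>. ?h (t * - X \<omega>))" for t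
      by (simp only: Bochner_Integration.integral_add[OF int_h] integral_mult_right_zero)
    finally have eq: "expectation (\<lambda>\<omega>. f (t * X \<omega>)) / g t = expectation (\<lambda>\<omega>. ?h (t * X \<omega>)) / g t + s * (expectation (\<lambda>\<omega>. ?h (t * - X \<omega>)) / L.g t)" for t
      by (simp only: Lg add_divide_distrib times_divide_eq_right)
    have "((\<lambda>t. expectation (\<lambda>\<omega>. f (t * X \<omega>)) / g t) \<longlongrightarrow>
       ?p * k * (LBINT x:{0<..}. f x * x powr (- k - 1)) + s * (?q * k * (LBINT x:{0<..}. f x * x powr (- k - 1)))) (at_right 0)"
      unfolding eq by (intro tendsto_add tendsto_mult_left right_half_limit[OF f int] L.right_half_limit[OF f int])
    then show ?thesis by (simp add: algebra_simps)
  qed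
  have "((\<lambda>t. expectation (\<lambda>\<omega>. (1 - cos (t * X \<omega>))\<^sup>2) / g t) \<longlongrightarrow>
      (?p + 1 * ?q) * k * (LBINT x:{0<..}. (1 - cos x)\<^sup>2 * x powr (- k - 1))) (at_right 0)"
  proof (rule two_sided)
    show "set_integrable lborel {0<..} (\<lambda>x. (1 - cos x)\<^sup>2 * x powr (- k - 1))"
      by (rule square_one_minus_cos_moment(1)[OF k_pos k_less_2])
    fix x :: real
    show "norm ((1 - cos x)\<^sup>2) \<le> 2\<^sup>2"
      unfolding norm_power using cos_ge_minus_one[of x] by (intro power_mono) auto
    show "\<bar>(1 - cos x)\<^sup>2\<bar> \<le> \<bar>x\<bar> * (1 - cos x)"
      using one_minus_cos_le_abs[of x] by (auto simp: power2_eq_square intro: mult_right_mono)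
  qed auto
  from tendsto_unique[OF _ square_one_minus_cos_limit this]
  have 1: "2 - 2 powr (k - 1) = (?p + ?q) * k * ((2 - 2 powr (k - 1)) * cos_moment k)"
    by (simp add: square_one_minus_cos_moment(2)[OF k_pos k_less_2])
  have "((\<lambda>t. expectation (\<lambda>\<omega>. sin (t * X \<omega>) * (1 - cos (t * X \<omega>))) / g t) \<longlongrightarrow>
      (?p + (-1) * ?q) * k * (LBINT x:{0<..}. sin x * (1 - cos x) * x powr (- k - 1))) (at_right 0)"
  proof (rule two_sided)
    show "set_integrable lborel {0<..} (\<lambda>x. sin x * (1 - cos x) * x powr (- k - 1))"
      by (rule set_integrable_sin_moment[OF k_pos k_less_2])
    fix x :: real
    show "norm (sin x * (1 - cos x)) \<le> 2"
      using abs_sin_le_1_minus_cos_bound[of x] cos_ge_minus_one[of x] unfolding real_norm_def by linarith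
    show "\<bar>sin x * (1 - cos x)\<bar> \<le> \<bar>x\<bar> * (1 - cos x)" by (rule abs_sin_mult_one_minus_cos_le)
  qed auto
  from tendsto_unique[OF _ sin_one_minus_cos_limit this]
  have 2: "c * (1 - 2 powr (k - 1)) = (?p - ?q) * k * sin_moment k"
    by (simp add: sin_moment_def)
  have "((\<lambda>t. expectation (\<lambda>\<omega>. step (1/2) (t * X \<omega>)) / g t) \<longlongrightarrow> ?p) (at_right 0)"
    using right_coeff(2)[of "1/2"] by (simp add: tail_def)
  moreover have "((\<lambda>t. expectation (\<lambda>\<omega>. step (1/2) (t * - X \<omega>)) / g t) \<longlongrightarrow> ?q) (at_right 0)"
    using L.right_coeff(2)[of "1/2"] by (simp add: L.tail_def Lg)
  ultimately show ?thesis using right_coeff(1) L.right_coeff(1) 1 2 by blast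
qed

text \<open>The weight 1/2 at the jump averages strict and non-strict inequalities, exactly as the
  intermediate distribution function does.\<close>

lemma expectation_step_half:
  assumes "x > 0"
  shows "expectation (\<lambda>\<omega>. step (1/2) (1 / x * X \<omega>)) = 1 - intermediate_df M X x"
    and "expectation (\<lambda>\<omega>. step (1/2) (1 / x * - X \<omega>)) = intermediate_df M X (- x)"
proof -
  let ?l = "\<lambda>x. {\<omega> \<in> space M. X \<omega> < x}" and ?le = "\<lambda>x. {\<omega> \<in> space M. X \<omega> \<le> x}"
  have int: "integrable M (indicat_real (?l x))" "integrable M (indicat_real (?le x))" for x
    by (auto intro!: integrable_real_indicator simp: less_top[symmetric])
  have "expectation (\<lambda>\<omega>. step (1/2) (1 / x * X \<omega>)) = expectation (\<lambda>\<omega>. 1 - (indicator (?l x) \<omega> + indicator (?le x) \<omega>) / 2)"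
    using assms by (intro Bochner_Integration.integral_cong) (auto simp: step_def indicator_def field_simps)
  then show "expectation (\<lambda>\<omega>. step (1/2) (1 / x * X \<omega>)) = 1 - intermediate_df M X x"
    using int[of x] by (simp add: intermediate_df_def prob_space)
  have "expectation (\<lambda>\<omega>. step (1/2) (1 / x * - X \<omega>)) = expectation (\<lambda>\<omega>. (indicator (?l (- x)) \<omega> + indicator (?le (- x)) \<omega>) / 2)"
    using assms by (intro Bochner_Integration.integral_cong) (auto simp: step_def indicator_def field_simps)
  then show "expectation (\<lambda>\<omega>. step (1/2) (1 / x * - X \<omega>)) = intermediate_df M X (- x)"
    using int[of "- x"] by (simp add: intermediate_df_def)
qed

end

theorem theorem6p4:
  fixes M :: "'a measure" and X :: "'a \<Rightarrow> real" and k c' :: real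
  assumes "prob_space M"
    and "X \<in> borel_measurable M"
    and "0 < k" and "k < 2" and "k \<noteq> 1"
    and "regularly_varying_at_0 (\<lambda>t. 1 - cf_U M X t) k"
    and "((\<lambda>t. cf_V M X t / (1 - cf_U M X t)) \<longlongrightarrow> c') (at_right 0)"
  shows "\<exists>\<beta>. ((\<lambda>x. tail_diff M X x / tail_sum M X x) \<longlongrightarrow> \<beta>) at_top
           \<and> \<beta> \<in> {-1..1} \<and> c' = \<beta> * tan (pi * k / 2)"
proof -
  interpret cf_reg_var M X k c'
    using assms by (simp add: cf_reg_var_def cf_reg_var_axioms_def)
  let ?R = "\<lambda>t. expectation (\<lambda>\<omega>. step (1/2) (t * X \<omega>))" and ?L = "\<lambda>t. expectation (\<lambda>\<omega>. step (1/2) (t * - X \<omega>))"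
  obtain p q where pq: "0 \<le> p" "0 \<le> q"
    and R: "((\<lambda>t. ?R t / g t) \<longlongrightarrow> p) (at_right 0)" and L: "((\<lambda>t. ?L t / g t) \<longlongrightarrow> q) (at_right 0)"
    and sq: "2 - 2 powr (k - 1) = (p + q) * k * ((2 - 2 powr (k - 1)) * cos_moment k)"
    and sn: "c' * (1 - 2 powr (k - 1)) = (p - q) * k * sin_moment k"
    using coefficients_exist by blast
  have "2 powr (k - 1) < 2 powr (1::real)" using k_less_2 by (intro powr_less_mono) auto
  then have "2 - 2 powr (k - 1) > 0" by simp
  \<comment> \<open>The positive factor 2 - 2^(k-1) cancels. The resulting normalisation also shows
    that p and q are not both 0, so the quotient below is well defined.\<close>
  with sq have one: "(p + q) * (k * cos_moment k) = 1" by (simp add: mult_ac)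
  then have pos: "p + q > 0" using pq by (cases "p + q = 0") auto
  \<comment> \<open>As k differs from 1, the common factor 1 - 2^(k-1) of the sine equation and of
    the closed form of \<open>sin_moment\<close> can be cancelled.\<close>
  have "1 - 2 powr (k - 1) \<noteq> 0" using assms(5) powr_inj[of 2 "k - 1" 0] by simp
  moreover have "c' * (1 - 2 powr (k - 1)) = (p - q) * (k * cos_moment k) * tan (pi * k / 2) * (1 - 2 powr (k - 1))"
    unfolding sn sin_moment_eq[OF assms(3-5)] by (simp add: mult_ac)
  ultimately have "c' = (p - q) * (k * cos_moment k) * tan (pi * k / 2)" by simp
  moreover have "k * cos_moment k = 1 / (p + q)" using one pos by (simp add: field_simps)
  ultimately have c: "c' = (p - q) / (p + q) * tan (pi * k / 2)" by simp
  \<comment> \<open>The unknown scale \<open>g t\<close> drops out of the quotient, leaving the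
    limit \<beta> = (p - q) / (p + q).\<close>
  have "((\<lambda>t. (?R t / g t - ?L t / g t) / (?R t / g t + ?L t / g t)) \<longlongrightarrow> (p - q) / (p + q)) (at_right 0)"
    using pos by (intro tendsto_intros R L) auto
  moreover have "\<forall>\<^sub>F t in at_right 0. (?R t / g t - ?L t / g t) / (?R t / g t + ?L t / g t) = (?R t - ?L t) / (?R t + ?L t)"
    using eventually_g_pos
    by eventually_elim (simp only: diff_divide_distrib[symmetric] add_divide_distrib[symmetric], simp)
  ultimately have "((\<lambda>t. (?R t - ?L t) / (?R t + ?L t)) \<longlongrightarrow> (p - q) / (p + q)) (at_right 0)"
    by (rule Lim_transform_eventually)
  \<comment> \<open>The substitution t = 1 / x turns the limit at 0 into one at infinity.\<close>
  moreover have "filterlim (\<lambda>x::real. 1 / x) (at_right 0) at_top" by real_asymp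
  ultimately have "((\<lambda>x. (?R (1 / x) - ?L (1 / x)) / (?R (1 / x) + ?L (1 / x))) \<longlongrightarrow> (p - q) / (p + q)) at_top"
    by (rule filterlim_compose)
  moreover have "\<forall>\<^sub>F x in at_top. (?R (1 / x) - ?L (1 / x)) / (?R (1 / x) + ?L (1 / x)) = tail_diff M X x / tail_sum M X x"
    using eventually_gt_at_top[of 0]
    by eventually_elim (simp only: expectation_step_half tail_diff_def tail_sum_def)
  ultimately have "((\<lambda>x. tail_diff M X x / tail_sum M X x) \<longlongrightarrow> (p - q) / (p + q)) at_top"
    by (rule Lim_transform_eventually)
  moreover have "(p - q) / (p + q) \<in> {-1..1}" using pq pos by (simp add: field_simps)
  ultimately show ?thesis using c by blast
qed

end
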